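(* Let $(\mathbb A,\beta)$ be an $s$-stage Runge--Kutta method that is A-stable, with $\mathbb A\in\mathbb R^{s\times s}$ invertible and $|R(\infty)|<1$, and that is algebraically stable, i.e. $\operatorname{diag}(\beta)\mathbb A+\mathbb A^{\mathsf T}\operatorname{diag}(\beta)-\beta\beta^{\mathsf T}\succeq0$ (positive semidefinite), with weights $\beta_\ell>0$ for all $\ell$. Then the undrained-split iteration with stabilization parameter $L$ (see context) satisfies, for every time step $n$ and every iteration index $i\ge2$, $$|U^{n,i}-U^{n,i-1}|_{\widetilde{\mathcal M},\beta}\le\rho_{\mathrm{US}}\,|U^{n,i-1}-U^{n,i-2}|_{\widetilde{\mathcal M},\beta}$$ with contraction rate $$\rho_{\mathrm{US}}=\frac{\omega\max(L,\,1-L)}{1+L\omega}.$$ In particular, $\rho_{\mathrm{US}}<1$ for all $L\ge\tfrac12$ (unconditionally), and for $0\le L<\tfrac12$ provided $\omega<1/(1-2L)$. The optimal choice $L=\tfrac12$ yields $\rho_{\mathrm{US}}=\omega/(2+\omega)$.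
   Context: Setting. $\Omega\subseteq\mathbb R^m$, $m\in\{2,3\}$, is a bounded Lipschitz domain, $\mathcal V=[H^1_0(\Omega)]^m$, $\mathcal Q=H^1_0(\Omega)$, $\mathcal H_{\mathcal V}=[L^2(\Omega)]^m$, $\mathcal H_{\mathcal Q}=L^2(\Omega)$, with the usual Gelfand triples. The bilinear forms $a:\mathcal V\times\mathcal V\to\mathbb R$, $b:\mathcal Q\times\mathcal Q\to\mathbb R$, $c:\mathcal H_{\mathcal Q}\times\mathcal H_{\mathcal Q}\to\mathbb R$ are symmetric, continuous and elliptic, with ellipticity constants $c_a,c_b,c_c>0$. The form $d:\mathcal V\times\mathcal H_{\mathcal Q}\to\mathbb R$ is bilinear and satisfies $d(u,p)\le C_d\|u\|_{\mathcal V}\|p\|_{\mathcal H_{\mathcal Q}}$ with $C_d>0$. The coupling strength is $\omega:=C_d^2/(c_ac_c)$. The operators $\mathcal A:\mathcal V\to\mathcal V^*$, $\mathcal B:\mathcal Q\to\mathcal Q^*$, $\mathcal C:\mathcal H_{\mathcal Q}\to\mathcal H_{\mathcal Q}^*$, $\mathcal D:\mathcal V\to\mathcal H_{\mathcal Q}^*$ are those associated with $a,b,c,d$. Set $\widetilde{\mathcal M}:=\mathcal D^*\mathcal C^{-1}\mathcal D:\mathcal V\to\mathcal V^*$, with semi-norm $|v|_{\widetilde{\mathcal M}}^2=\langle\widetilde{\mathcal M}v,v\rangle=\langle\mathcal C^{-1}\mathcal Dv,\mathcal Dv\rangle$ for $v\in\mathcal V$, and $|V|_{\widetilde{\mathcal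 M},\beta}^2=\sum_{\ell=1}^s\beta_\ell|V_\ell|_{\widetilde{\mathcal M}}^2$ for $V\in\mathcal V^s$. Runge--Kutta method. $\beta\in\mathbb R^s$, $\mathbf 1=[1,\dots,1]^{\mathsf T}\in\mathbb R^s$, $\chi=\mathbb A\mathbf 1$, $R(z)=1+z\beta^{\mathsf T}(I_s-z\mathbb A)^{-1}\mathbf 1$, $R(\infty)=1-\beta^{\mathsf T}\mathbb A^{-1}\mathbf 1$; A-stable means $|R(z)|\le1$ for $\operatorname{Re}z\le0$. Undrained-split iteration. Let $L\ge0$, $\tau>0$, $t^n=n\tau$, $F^n_\ell=f(t^{n-1}+\chi_\ell\tau)$, $G^n_\ell=g(t^{n-1}+\chi_\ell\tau)$ for given $f:[0,T]\to\mathcal V^*$, $g:[0,T]\to\mathcal Q^*$. At time step $n$, with $u^{n-1},p^{n-1}$ given, set $U^{n,0}=\mathbf 1u^{n-1}$, $P^{n,0}=\mathbf 1p^{n-1}$ (all stages equal to the solution from the previous time step), and for $i\ge1$ let $U^{n,i}\in\mathcal V^s$, $P^{n,i}\in\mathcal Q^s$ solve $$(I_s\otimes\mathcal A)U^{n,i}-(I_s\otimes\mathcal D^* )P^{n,i-1}+L(I_s\otimes\widetilde{\mathcal M})(U^{n,i}-U^{n,i-1})=F^n\quad\text{in }(\mathcal V^* )^s,$$ $$(I_s\otimes\mathcal D)\dot U^{n,i}+(I_s\otimes\mathcal C)\dot P^{n,i}+(I_s\otimes\mathcal B)P^{n,i}=G^n\quad\text{in }(\mathcal Q^* )^s,$$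 where $\dot U^{n,i}=\tfrac1\tau\mathbb A^{-1}(U^{n,i}-\mathbf 1u^{n-1})$ and $\dot P^{n,i}=\tfrac1\tau\mathbb A^{-1}(P^{n,i}-\mathbf 1p^{n-1})$.
   Formalization: At i=2 the estimate is proved only if the initial guess satisfies the flow equation (B p^{n-1} = G^n at every stage), since it fails otherwise (implicit Euler, zero data, f=0, constant g≠0); for all i≥3 it is as stated. *)

theory Defs
  imports "HOL-Analysis.Analysis"
begin

section \<open>Bounded Lipschitz domains\<close>

text \<open>
  Near each boundary point the set is, in the direction of a unit vector \<open>\<nu>\<close>, the strict epigraph
  of a Lipschitz function \<open>\<gamma>\<close> on the hyperplane orthogonal to \<open>\<nu>\<close>.
\<close>

definition lipschitz_boundary :: "'a::euclidean_space set \<Rightarrow> bool" where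
  "lipschitz_boundary \<Omega> \<longleftrightarrow>
     (\<forall>x0 \<in> frontier \<Omega>. \<exists>\<nu> r K \<gamma>.
        norm \<nu> = 1 \<and> 0 < r \<and> K-lipschitz_on {y. y \<bullet> \<nu> = 0} \<gamma> \<and>
        \<Omega> \<inter> ball x0 r = {x \<in> ball x0 r. \<gamma> (x - (x \<bullet> \<nu>) *\<^sub>R \<nu>) < x \<bullet> \<nu>})"

definition bounded_lipschitz_domain :: "'a::euclidean_space set \<Rightarrow> bool" where
  "bounded_lipschitz_domain \<Omega> \<longleftrightarrow>
     \<Omega> \<noteq> {} \<and> open \<Omega> \<and> connected \<Omega> \<and> bounded \<Omega> \<and> lipschitz_boundary \<Omega>"


section \<open>Function spaces\<close>

text \<open>
  Elements of Lebesgue and Sobolev spaces are represented by functions on the whole space, of which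
  only the almost-everywhere class on \<open>\<Omega>\<close> matters; the norms below are therefore
  seminorms on representatives. A form that is bilinear and bounded with respect to them
  automatically respects almost-everywhere equality.
\<close>

definition L2 :: "(real^'m) set \<Rightarrow> (real^'m \<Rightarrow> real) set" where
  "L2 \<Omega> = {f \<in> borel_measurable (lebesgue_on \<Omega>). integrable (lebesgue_on \<Omega>) (\<lambda>x. (f x)\<^sup>2)}"

definition L2_norm :: "(real^'m) set \<Rightarrow> (real^'m \<Rightarrow> real) \<Rightarrow> real" where
  "L2_norm \<Omega> f = sqrt (integral\<^sup>L (lebesgue_on \<Omega>) (\<lambda>x. (f x)\<^sup>2))"

definition partial_deriv :: "'m \<Rightarrow> (real^'m \<Rightarrow> real) \<Rightarrow> real^'m \<Rightarrow> real" where
  "partial_deriv i f x = frechet_derivative f (at x) (axis i 1)"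

primrec iter_partial :: "'m list \<Rightarrow> (real^'m \<Rightarrow> real) \<Rightarrow> real^'m \<Rightarrow> real" where
  "iter_partial [] f = f"
| "iter_partial (i # js) f = partial_deriv i (iter_partial js f)"

text \<open>
  Differentiability of all iterated partial derivatives makes them all continuous, so this
  is \<open>C\<^sup>\<infinity>\<close>.
\<close>

definition smooth :: "(real^'m \<Rightarrow> real) \<Rightarrow> bool" where
  "smooth f \<longleftrightarrow> (\<forall>js x. iter_partial js f differentiable (at x))"

definition test_functions :: "(real^'m) set \<Rightarrow> (real^'m \<Rightarrow> real) set" where
  "test_functions \<Omega> = {\<phi>. smooth \<phi> \<and> (\<exists>K. compact K \<and> K \<subseteq> \<Omega> \<and> (\<forall>x. x \<notin> K \<longrightarrow> \<phi> x = 0))}"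

definition has_weak_gradient ::
    "(real^'m) set \<Rightarrow> (real^'m \<Rightarrow> real) \<Rightarrow> (real^'m \<Rightarrow> real^'m) \<Rightarrow> bool" where
  "has_weak_gradient \<Omega> u g \<longleftrightarrow>
     u \<in> L2 \<Omega> \<and> (\<forall>i. (\<lambda>x. g x $ i) \<in> L2 \<Omega>) \<and>
     (\<forall>\<phi> \<in> test_functions \<Omega>. \<forall>i.
        integral\<^sup>L (lebesgue_on \<Omega>) (\<lambda>x. u x * partial_deriv i \<phi> x) =
        - integral\<^sup>L (lebesgue_on \<Omega>) (\<lambda>x. g x $ i * \<phi> x))"

text \<open>Weak gradients are unique only almost everywhere; the choice does not affect the norm.\<close>

definition weak_gradient :: "(real^'m) set \<Rightarrow> (real^'m \<Rightarrow> real) \<Rightarrow> real^'m \<Rightarrow> real^'m" where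
  "weak_gradient \<Omega> u = (SOME g. has_weak_gradient \<Omega> u g)"

definition H1_norm :: "(real^'m) set \<Rightarrow> (real^'m \<Rightarrow> real) \<Rightarrow> real" where
  "H1_norm \<Omega> u =
     sqrt ((L2_norm \<Omega> u)\<^sup>2 + (\<Sum>i\<in>UNIV. (L2_norm \<Omega> (\<lambda>x. weak_gradient \<Omega> u x $ i))\<^sup>2))"

text \<open>
  The closure of the test functions in \<open>H\<^sup>1(\<Omega>)\<close>: the functions that, together with a weak
  gradient, are \<open>L\<^sup>2\<close>-limits of test functions and their gradients.
\<close>

definition H10 :: "(real^'m) set \<Rightarrow> (real^'m \<Rightarrow> real) set" where
  "H10 \<Omega> = {u. \<exists>g. has_weak_gradient \<Omega> u g \<and>
     (\<exists>\<phi>. (\<forall>k::nat. \<phi> k \<in> test_functions \<Omega>) \<and>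
        (\<lambda>k. L2_norm \<Omega> (\<lambda>x. \<phi> k x - u x)) \<longlonglongrightarrow> 0 \<and>
        (\<forall>i. (\<lambda>k. L2_norm \<Omega> (\<lambda>x. partial_deriv i (\<phi> k) x - g x $ i)) \<longlonglongrightarrow> 0))}"

definition H10_vec :: "(real^'m) set \<Rightarrow> (real^'m \<Rightarrow> real^'m) set" where
  "H10_vec \<Omega> = {v. \<forall>i. (\<lambda>x. v x $ i) \<in> H10 \<Omega>}"

definition H1_vec_norm :: "(real^'m) set \<Rightarrow> (real^'m \<Rightarrow> real^'m) \<Rightarrow> real" where
  "H1_vec_norm \<Omega> v = sqrt (\<Sum>i\<in>UNIV. (H1_norm \<Omega> (\<lambda>x. v x $ i))\<^sup>2)"


section \<open>Functionals, bilinear forms and their operators\<close>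

definition linear_functional_on :: "('a \<Rightarrow> 'b::real_vector) set \<Rightarrow> (('a \<Rightarrow> 'b) \<Rightarrow> real) \<Rightarrow> bool" where
  "linear_functional_on X \<phi> \<longleftrightarrow>
     (\<forall>v\<in>X. \<forall>w\<in>X. \<phi> (\<lambda>x. v x + w x) = \<phi> v + \<phi> w) \<and>
     (\<forall>k. \<forall>v\<in>X. \<phi> (\<lambda>x. k *\<^sub>R v x) = k * \<phi> v)"

text \<open>The dual of the space \<open>X\<close> with norm \<open>N\<close>; functionals are made \<open>undefined\<close> off \<open>X\<close>.\<close>

definition dual_space ::
    "('a \<Rightarrow> 'b::real_vector) set \<Rightarrow> (('a \<Rightarrow> 'b) \<Rightarrow> real) \<Rightarrow> (('a \<Rightarrow> 'b) \<Rightarrow> real) set" where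
  "dual_space X N = {\<phi> \<in> extensional X. linear_functional_on X \<phi> \<and> (\<exists>K. \<forall>v\<in>X. \<bar>\<phi> v\<bar> \<le> K * N v)}"

definition bilinear_form_on ::
    "('a \<Rightarrow> 'b::real_vector) set \<Rightarrow> ('a \<Rightarrow> 'c::real_vector) set \<Rightarrow>
     (('a \<Rightarrow> 'b) \<Rightarrow> ('a \<Rightarrow> 'c) \<Rightarrow> real) \<Rightarrow> bool" where
  "bilinear_form_on X Y e \<longleftrightarrow>
     (\<forall>v\<in>X. linear_functional_on Y (e v)) \<and> (\<forall>w\<in>Y. linear_functional_on X (\<lambda>v. e v w))"

definition symmetric_form_on :: "'v set \<Rightarrow> ('v \<Rightarrow> 'v \<Rightarrow> real) \<Rightarrow> bool" where
  "symmetric_form_on X e \<longleftrightarrow> (\<forall>v\<in>X. \<forall>w\<in>X. e v w = e w v)"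

definition continuous_form_on :: "'v set \<Rightarrow> ('v \<Rightarrow> real) \<Rightarrow> ('v \<Rightarrow> 'v \<Rightarrow> real) \<Rightarrow> bool" where
  "continuous_form_on X N e \<longleftrightarrow> (\<exists>K. \<forall>v\<in>X. \<forall>w\<in>X. \<bar>e v w\<bar> \<le> K * N v * N w)"

definition elliptic_form_on ::
    "'v set \<Rightarrow> ('v \<Rightarrow> real) \<Rightarrow> real \<Rightarrow> ('v \<Rightarrow> 'v \<Rightarrow> real) \<Rightarrow> bool" where
  "elliptic_form_on X N \<kappa> e \<longleftrightarrow> 0 < \<kappa> \<and> (\<forall>v\<in>X. \<kappa> * (N v)\<^sup>2 \<le> e v v)"

definition sym_cont_elliptic_form ::
    "('a \<Rightarrow> 'b::real_vector) set \<Rightarrow> (('a \<Rightarrow> 'b) \<Rightarrow> real) \<Rightarrow> real \<Rightarrow>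
     (('a \<Rightarrow> 'b) \<Rightarrow> ('a \<Rightarrow> 'b) \<Rightarrow> real) \<Rightarrow> bool" where
  "sym_cont_elliptic_form X N \<kappa> e \<longleftrightarrow>
     bilinear_form_on X X e \<and> symmetric_form_on X e \<and> continuous_form_on X N e \<and>
     elliptic_form_on X N \<kappa> e"

text \<open>The operator \<open>v \<mapsto> e(v, \<cdot>)\<close> into the dual of \<open>Y\<close>, and its adjoint \<open>w \<mapsto> e(\<cdot>, w)\<close>.\<close>

definition form_op :: "'w set \<Rightarrow> ('v \<Rightarrow> 'w \<Rightarrow> real) \<Rightarrow> 'v \<Rightarrow> 'w \<Rightarrow> real" where
  "form_op Y e v = restrict (e v) Y"

definition form_op_adj :: "'v set \<Rightarrow> ('v \<Rightarrow> 'w \<Rightarrow> real) \<Rightarrow> 'w \<Rightarrow> 'v \<Rightarrow> real" where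
  "form_op_adj X e w = restrict (\<lambda>v. e v w) X"

text \<open>
  \<open>D\<^sup>* C\<inverse> D\<close>, where \<open>C\<inverse>\<close> sends a functional to a representative of its preimage under
  \<open>C : L\<^sup>2(\<Omega>) \<rightarrow> L\<^sup>2(\<Omega>)\<^sup>*\<close>; that preimage is unique up to almost-everywhere equality.
\<close>

definition M_tilde ::
    "(real^'m) set \<Rightarrow> ((real^'m \<Rightarrow> real) \<Rightarrow> (real^'m \<Rightarrow> real) \<Rightarrow> real) \<Rightarrow>
     ((real^'m \<Rightarrow> real^'m) \<Rightarrow> (real^'m \<Rightarrow> real) \<Rightarrow> real) \<Rightarrow>
     (real^'m \<Rightarrow> real^'m) \<Rightarrow> (real^'m \<Rightarrow> real^'m) \<Rightarrow> real" where
  "M_tilde \<Omega> c d v =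
     form_op_adj (H10_vec \<Omega>) d
       (inv_into (L2 \<Omega>) (form_op (L2 \<Omega>) c) (form_op (L2 \<Omega>) d v))"

definition M_seminorm ::
    "(real^'m) set \<Rightarrow> ((real^'m \<Rightarrow> real) \<Rightarrow> (real^'m \<Rightarrow> real) \<Rightarrow> real) \<Rightarrow>
     ((real^'m \<Rightarrow> real^'m) \<Rightarrow> (real^'m \<Rightarrow> real) \<Rightarrow> real) \<Rightarrow>
     (real^'m \<Rightarrow> real^'m) \<Rightarrow> real" where
  "M_seminorm \<Omega> c d v = sqrt (M_tilde \<Omega> c d v v)"

definition M_seminorm_stages ::
    "(real^'m) set \<Rightarrow> ((real^'m \<Rightarrow> real) \<Rightarrow> (real^'m \<Rightarrow> real) \<Rightarrow> real) \<Rightarrow>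
     ((real^'m \<Rightarrow> real^'m) \<Rightarrow> (real^'m \<Rightarrow> real) \<Rightarrow> real) \<Rightarrow>
     real^'s \<Rightarrow> ('s \<Rightarrow> real^'m \<Rightarrow> real^'m) \<Rightarrow> real" where
  "M_seminorm_stages \<Omega> c d \<beta> V = sqrt (\<Sum>l\<in>UNIV. \<beta> $ l * (M_seminorm \<Omega> c d (V l))\<^sup>2)"


section \<open>Runge--Kutta methods\<close>

definition abscissae :: "real^'s^'s \<Rightarrow> real^'s" where
  "abscissae A = A *v vec 1"

text \<open>\<open>I - z A\<close> as a complex matrix.\<close>

definition resolvent_matrix :: "real^'s^'s \<Rightarrow> complex \<Rightarrow> complex^'s^'s" where
  "resolvent_matrix A z = mat 1 - (\<chi> i j. z * complex_of_real (A $ i $ j))"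

definition stability_fun :: "real^'s^'s \<Rightarrow> real^'s \<Rightarrow> complex \<Rightarrow> complex" where
  "stability_fun A \<beta> z =
     1 + z * (\<Sum>l\<in>UNIV. complex_of_real (\<beta> $ l) * (matrix_inv (resolvent_matrix A z) *v vec 1) $ l)"

definition stability_fun_infinity :: "real^'s^'s \<Rightarrow> real^'s \<Rightarrow> real" where
  "stability_fun_infinity A \<beta> = 1 - \<beta> \<bullet> (matrix_inv A *v vec 1)"

text \<open>
  The formula for \<open>R(z)\<close> is meaningful where \<open>I - z A\<close> is invertible, i.e. for all but finitely many
  \<open>z\<close>. Bounding \<open>R\<close> there is the same as bounding the rational function \<open>R\<close> on the half-plane.
\<close>

definition A_stable :: "real^'s^'s \<Rightarrow> real^'s \<Rightarrow> bool" where
  "A_stable A \<beta> \<longleftrightarrow>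
     (\<forall>z. Re z \<le> 0 \<and> invertible (resolvent_matrix A z) \<longrightarrow> cmod (stability_fun A \<beta> z) \<le> 1)"

definition diag :: "real^'s \<Rightarrow> real^'s^'s" where
  "diag \<beta> = (\<chi> i j. if i = j then \<beta> $ i else 0)"

definition positive_semidefinite :: "real^'s^'s \<Rightarrow> bool" where
  "positive_semidefinite M \<longleftrightarrow> transpose M = M \<and> (\<forall>x. 0 \<le> x \<bullet> (M *v x))"

definition algebraically_stable :: "real^'s^'s \<Rightarrow> real^'s \<Rightarrow> bool" where
  "algebraically_stable A \<beta> \<longleftrightarrow>
     positive_semidefinite (diag \<beta> ** A + transpose A ** diag \<beta> - (\<chi> i j. \<beta> $ i * \<beta> $ j))"

text \<open>The stage derivatives \<open>\<tau>\<inverse> A\<inverse> (W - \<one> w\<^sub>0)\<close>.\<close>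

definition stage_deriv ::
    "real^'s^'s \<Rightarrow> real \<Rightarrow> ('a \<Rightarrow> 'b::real_vector) \<Rightarrow> ('s \<Rightarrow> 'a \<Rightarrow> 'b) \<Rightarrow> 's \<Rightarrow> 'a \<Rightarrow> 'b" where
  "stage_deriv A \<tau> w0 W l = (\<lambda>x. (1 / \<tau>) *\<^sub>R (\<Sum>j\<in>UNIV. matrix_inv A $ l $ j *\<^sub>R (W j x - w0 x)))"


section \<open>The undrained-split iteration\<close>

text \<open>
  In the following, \<open>U l\<close> and \<open>P l\<close> are the \<open>l\<close>-th components of stage vectors. The equations hold
  stagewise, as identities between functionals on \<open>H\<^sup>1\<^sub>0\<close>.
\<close>

definition stage_time :: "real^'s^'s \<Rightarrow> real \<Rightarrow> nat \<Rightarrow> 's \<Rightarrow> real" where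
  "stage_time A \<tau> n l = (real n - 1) * \<tau> + abscissae A $ l * \<tau>"

text \<open>The mechanics equation, with \<open>U'\<close> and \<open>P'\<close> the previous iterates.\<close>

definition mechanics_equation where
  "mechanics_equation \<Omega> a c d A \<tau> L f n U' P' U \<longleftrightarrow>
     (\<forall>l. \<forall>v \<in> H10_vec \<Omega>.
        form_op (H10_vec \<Omega>) a (U l) v
        - form_op_adj (H10_vec \<Omega>) d (P' l) v
        + L * M_tilde \<Omega> c d (\<lambda>x. U l x - U' l x) v
        = f (stage_time A \<tau> n l) v)"

text \<open>
  The flow equation; the functionals \<open>D U\<close> and \<open>C P\<close> on \<open>L\<^sup>2\<close> are restricted to \<open>H\<^sup>1\<^sub>0\<close>.
\<close>

definition flow_equation where
  "flow_equation \<Omega> b c d A \<tau> g n u0 p0 U P \<longleftrightarrow>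
     (\<forall>l. \<forall>q \<in> H10 \<Omega>.
        form_op (L2 \<Omega>) d (stage_deriv A \<tau> u0 U l) q
        + form_op (L2 \<Omega>) c (stage_deriv A \<tau> p0 P l) q
        + form_op (H10 \<Omega>) b (P l) q
        = g (stage_time A \<tau> n l) q)"

text \<open>
  One time step, started from \<open>u0 = u\<^sup>n\<^sup>-\<^sup>1\<close> and \<open>p0 = p\<^sup>n\<^sup>-\<^sup>1\<close>; \<open>U i\<close> and \<open>P i\<close> are the \<open>i\<close>-th iterates.
  The initial guess \<open>U 0\<close>, \<open>P 0\<close> need not satisfy the flow equation.
\<close>

definition undrained_split_iteration where
  "undrained_split_iteration \<Omega> a b c d A \<tau> L f g n u0 p0 U P \<longleftrightarrow>
     u0 \<in> H10_vec \<Omega> \<and> p0 \<in> H10 \<Omega> \<and>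
     (\<forall>i l. U i l \<in> H10_vec \<Omega> \<and> P i l \<in> H10 \<Omega>) \<and>
     (\<forall>l. U 0 l = u0 \<and> P 0 l = p0) \<and>
     (\<forall>i::nat. 1 \<le> i \<longrightarrow>
        mechanics_equation \<Omega> a c d A \<tau> L f n (U (i - 1)) (P (i - 1)) (U i) \<and>
        flow_equation \<Omega> b c d A \<tau> g n u0 p0 (U i) (P i))"

definition rho_US :: "real \<Rightarrow> real \<Rightarrow> real" where
  "rho_US \<omega> L = \<omega> * max L (1 - L) / (1 + L * \<omega>)"

end

theory Submission
  imports Defs
begin

text \<open>
  Write \<open>y\<close>, \<open>x\<close> and \<open>p\<close> for the stagewise differences \<open>C\<^sup>-\<^sup>1D(U\<^sup>i - U\<^sup>i\<^sup>-\<^sup>1)\<close>,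
  \<open>C\<^sup>-\<^sup>1D(U\<^sup>i\<^sup>-\<^sup>1 - U\<^sup>i\<^sup>-\<^sup>2)\<close> and \<open>P\<^sup>i\<^sup>-\<^sup>1 - P\<^sup>i\<^sup>-\<^sup>2\<close>, and measure them in the norm
  of \<open>c\<close> weighted by \<open>\<beta>\<close>, so that \<open>\<bar>y\<bar>\<close> and \<open>\<bar>x\<bar>\<close> are the two sides of the estimate. Since
  \<open>\<bar>v\<bar>\<^sub>M\<^sup>2 \<le> \<omega> a(v, v)\<close>, testing the mechanics equation with \<open>U\<^sup>i - U\<^sup>i\<^sup>-\<^sup>1\<close> gives
  \<open>(1/\<omega> + L) \<bar>y\<bar> \<le> \<bar>p + L x\<bar>\<close>. The flow equation says \<open>c(x\<^sub>k + p\<^sub>k, q) = -\<tau> \<Sum>\<^sub>l A\<^sub>k\<^sub>l b(p\<^sub>l, q)\<close>;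
  testing with \<open>q = \<beta>\<^sub>k p\<^sub>k\<close> and summing, algebraic stability and the Schur product inequality
  for positive semidefinite matrices give \<open>\<langle>x + p, p\<rangle> \<le> 0\<close>. So \<open>p\<close> lies in the ball of
  radius \<open>\<bar>x\<bar> / 2\<close> around \<open>-x / 2\<close>, whence \<open>\<bar>p + L x\<bar> \<le> (1/2 + \<bar>L - 1/2\<bar>) \<bar>x\<bar> = max(L, 1 - L) \<bar>x\<bar>\<close>.

  The existence of \<open>C\<^sup>-\<^sup>1\<close> on \<open>L\<^sup>2(\<Omega>)\<^sup>*\<close> rests on the completeness of \<open>L\<^sup>2(\<Omega>)\<close>.
\<close>

section \<open>Positive semidefinite kernels\<close>

text \<open>
  Eliminating the index \<open>k\<close> replaces \<open>Q\<close> by its Schur complement, which is again positive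
  semidefinite, plus a rank-one kernel. If \<open>Q k k = 0\<close> then row \<open>k\<close> vanishes, so the junk value
  \<open>x / 0 = 0\<close> is harmless.
\<close>

lemma psd_kernel_inner_nonneg:
  fixes Q G :: "'i \<Rightarrow> 'i \<Rightarrow> real"
  assumes "finite S"
    and "\<And>i j. Q i j = Q j i"
    and "\<And>x. 0 \<le> (\<Sum>i\<in>S. \<Sum>j\<in>S. x i * x j * Q i j)"
    and G: "\<And>x. 0 \<le> (\<Sum>i\<in>S. \<Sum>j\<in>S. x i * x j * G i j)"
  shows "0 \<le> (\<Sum>i\<in>S. \<Sum>j\<in>S. Q i j * G i j)"
  using assms
proof (induction S arbitrary: Q rule: finite_induct)
  case empty
  then show ?case by simp
next
  case (insert k S)
  note sym = insert.prems(1) and Q = insert.prems(2) and G = insert.prems(3)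
  have split: "(\<Sum>i\<in>insert k S. \<Sum>j\<in>insert k S. H i j) =
      H k k + (\<Sum>j\<in>S. H k j) + (\<Sum>i\<in>S. H i k) + (\<Sum>i\<in>S. \<Sum>j\<in>S. H i j)" for H :: "'i \<Rightarrow> 'i \<Rightarrow> real"
    using insert.hyps by (simp add: sum.distrib)
  \<comment> \<open>The form of \<open>Q\<close> at the vector with entry \<open>t\<close> at
    \<open>k\<close> and entries \<open>x\<close> on \<open>S\<close>, as a quadratic polynomial in
    \<open>t\<close>; the three facts below come from special choices of \<open>t\<close>.\<close>
  have quad: "0 \<le> t\<^sup>2 * Q k k + 2 * t * (\<Sum>j\<in>S. x j * Q k j) + (\<Sum>i\<in>S. \<Sum>j\<in>S. x i * x j * Q i j)"
    for t x
  proof -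
    let ?y = "x(k := t)"
    have y: "?y j = x j" if "j \<in> S" for j
      using that insert.hyps by auto
    have s1: "(\<Sum>j\<in>S. ?y k * ?y j * Q k j) = t * (\<Sum>j\<in>S. x j * Q k j)"
      unfolding sum_distrib_left by (intro sum.cong) (auto simp: y insert.hyps)
    have s2: "(\<Sum>j\<in>S. ?y j * ?y k * Q j k) = t * (\<Sum>j\<in>S. x j * Q k j)"
      unfolding sum_distrib_left
    proof (intro sum.cong refl)
      fix j assume "j \<in> S"
      then have "j \<noteq> k"
        using insert.hyps by blast
      then show "?y j * ?y k * Q j k = t * (x j * Q k j)"
        using sym[of j k] by simp
    qed
    have s3: "(\<Sum>i\<in>S. \<Sum>j\<in>S. ?y i * ?y j * Q i j) = (\<Sum>i\<in>S. \<Sum>j\<in>S. x i * x j * Q i j)"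
      using insert.hyps by (intro sum.cong refl) (simp add: y del: fun_upd_apply)
    show ?thesis
      using Q[of ?y] unfolding split s1 s2 s3 by (simp add: power2_eq_square)
  qed
  have kk: "0 \<le> Q k k"
    using quad[of 1 "\<lambda>_. 0"] by simp
  have row: "Q k j = 0" if "Q k k = 0" "j \<in> S" for j
  proof (rule ccontr)
    assume nz: "Q k j \<noteq> 0"
    let ?x = "\<lambda>i. if i = j then 1 else 0 :: real"
    have pick: "(\<Sum>i\<in>S. ?x i * h i) = h j" for h
    proof -
      have "(\<Sum>i\<in>S - {j}. ?x i * h i) = 0"
        by (intro sum.neutral) auto
      then show ?thesis
        using sum.remove[OF insert.hyps(1) that(2), of "\<lambda>i. ?x i * h i"] by simp
    qed
    have e2: "(\<Sum>i\<in>S. \<Sum>l\<in>S. ?x i * ?x l * Q i l) = Q j j"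
      unfolding mult.assoc sum_distrib_left[symmetric] pick ..
    \<comment> \<open>With \<open>Q k k = 0\<close> the polynomial is affine in \<open>t\<close>
      with nonzero slope; this \<open>t\<close> makes its value -1.\<close>
    have "0 \<le> 2 * (- (1 + Q j j) / (2 * Q k j)) * Q k j + Q j j"
      using quad[of "- (1 + Q j j) / (2 * Q k j)" ?x] that(1) unfolding pick e2 by simp
    also have "\<dots> = -1"
      using nz by (simp add: field_simps)
    finally show False by simp
  qed
  define Q' where "Q' i j = Q i j - Q k i * Q k j / Q k k" for i j
  have Q'psd: "0 \<le> (\<Sum>i\<in>S. \<Sum>j\<in>S. x i * x j * Q' i j)" for x
  proof -
    let ?s = "\<Sum>j\<in>S. x j * Q k j"
    have "(\<Sum>i\<in>S. \<Sum>j\<in>S. x i * x j * Q' i j) =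
        (\<Sum>i\<in>S. \<Sum>j\<in>S. x i * x j * Q i j) - (\<Sum>i\<in>S. \<Sum>j\<in>S. (x i * Q k i) * (x j * Q k j) / Q k k)"
      unfolding sum_subtractf[symmetric] by (intro sum.cong) (auto simp: Q'_def algebra_simps)
    also have "(\<Sum>i\<in>S. \<Sum>j\<in>S. (x i * Q k i) * (x j * Q k j) / Q k k) = ?s * ?s / Q k k"
      by (simp add: sum_product sum_divide_distrib)
    \<comment> \<open>For \<open>Q k k > 0\<close> the value \<open>t = - ?s / Q k k\<close>
      minimizes the polynomial; for \<open>Q k k = 0\<close> both quotients are 0 and the identity
      is trivial.\<close>
    also have "(\<Sum>i\<in>S. \<Sum>j\<in>S. x i * x j * Q i j) - ?s * ?s / Q k k =
       (- ?s / Q k k)\<^sup>2 * Q k k + 2 * (- ?s / Q k k) * ?s + (\<Sum>i\<in>S. \<Sum>j\<in>S. x i * x j * Q i j)"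
      by (cases "Q k k = 0") (simp_all add: power2_eq_square field_simps)
    finally show ?thesis
      using quad[of "- ?s / Q k k" x] by simp
  qed
  have GS: "0 \<le> (\<Sum>i\<in>S. \<Sum>j\<in>S. x i * x j * G i j)" for x
  proof -
    let ?y = "x(k := 0)"
    have y: "?y j = x j" if "j \<in> S" for j
      using that insert.hyps by auto
    have "(\<Sum>i\<in>S. \<Sum>j\<in>S. ?y i * ?y j * G i j) = (\<Sum>i\<in>S. \<Sum>j\<in>S. x i * x j * G i j)"
      using insert.hyps by (intro sum.cong refl) (simp add: y del: fun_upd_apply)
    then show ?thesis
      using G[of ?y] unfolding split by simp
  qed
  have Q'sym: "Q' i j = Q' j i" for i j
    using sym[of i j] by (simp add: Q'_def)
  have IH: "0 \<le> (\<Sum>i\<in>S. \<Sum>j\<in>S. Q' i j * G i j)"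
    by (rule insert.IH[OF Q'sym Q'psd GS])
  have Q'k: "Q' k j = 0 \<and> Q' j k = 0" if "j \<in> insert k S" for j
    using that row[of j] sym[of j k] by (cases "Q k k = 0") (auto simp: Q'_def)
  have "(\<Sum>i\<in>insert k S. \<Sum>j\<in>insert k S. Q i j * G i j) =
      (\<Sum>i\<in>insert k S. \<Sum>j\<in>insert k S. Q' i j * G i j) +
      (\<Sum>i\<in>insert k S. \<Sum>j\<in>insert k S. Q k i * Q k j * G i j) / Q k k"
    unfolding sum_divide_distrib sum.distrib[symmetric]
    by (intro sum.cong) (auto simp: Q'_def algebra_simps)
  moreover have "(\<Sum>i\<in>insert k S. \<Sum>j\<in>insert k S. Q' i j * G i j) = (\<Sum>i\<in>S. \<Sum>j\<in>S. Q' i j * G i j)"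
    unfolding split using Q'k by simp
  ultimately show ?case
    using IH kk G[of "Q k"] by simp
qed

section \<open>Square-integrable functions\<close>

lemma sum_square_le: "(a + b)\<^sup>2 \<le> 2 * a\<^sup>2 + 2 * b\<^sup>2" for a b :: real
  using sum_squares_bound[of a b] by (simp add: power2_sum)

lemma integrable_square_add:
  fixes u v :: "'a \<Rightarrow> real"
  assumes "u \<in> borel_measurable M" "v \<in> borel_measurable M"
    and "integrable M (\<lambda>x. (u x)\<^sup>2)" "integrable M (\<lambda>x. (v x)\<^sup>2)"
  shows "integrable M (\<lambda>x. (u x + v x)\<^sup>2)"
  by (rule Bochner_Integration.integrable_bound[where f="\<lambda>x. 2 * (u x)\<^sup>2 + 2 * (v x)\<^sup>2"])
    (use assms sum_square_le in auto)

lemma integrable_mult_square: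
  fixes u v :: "'a \<Rightarrow> real"
  assumes "u \<in> borel_measurable M" "v \<in> borel_measurable M"
    and "integrable M (\<lambda>x. (u x)\<^sup>2)" "integrable M (\<lambda>x. (v x)\<^sup>2)"
  shows "integrable M (\<lambda>x. u x * v x)"
proof (rule Bochner_Integration.integrable_bound[where f="\<lambda>x. (u x)\<^sup>2 + (v x)\<^sup>2"])
  have "norm (u x * v x) \<le> norm ((u x)\<^sup>2 + (v x)\<^sup>2)" for x
  proof -
    have "2 * (\<bar>u x\<bar> * \<bar>v x\<bar>) \<le> (u x)\<^sup>2 + (v x)\<^sup>2"
      using sum_squares_bound[of "\<bar>u x\<bar>" "\<bar>v x\<bar>"] by (simp add: mult.assoc)
    moreover have "0 \<le> \<bar>u x\<bar> * \<bar>v x\<bar>"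
      by simp
    ultimately show ?thesis
      unfolding real_norm_def abs_mult by linarith
  qed
  then show "AE x in M. norm (u x * v x) \<le> norm ((u x)\<^sup>2 + (v x)\<^sup>2)"
    by simp
qed (use assms in auto)

text \<open>
  Along a subsequence with \<open>\<integral>h\<^sub>k\<^sup>2 < 4\<^sup>-\<^sup>k\<close> for the increments \<open>h\<^sub>k\<close>, the series
  \<open>\<Sum> 2\<^sup>k h\<^sub>k\<^sup>2\<close> is integrable, and \<open>\<bar>h\<^sub>k\<bar> \<le> 2\<^sup>k h\<^sub>k\<^sup>2 + 2\<^sup>-\<^sup>k\<close> then gives pointwise convergence almost
  everywhere without Minkowski's inequality; Fatou's lemma turns this into convergence in mean square.
\<close>

lemma L2_complete:
  fixes f :: "nat \<Rightarrow> 'a \<Rightarrow> real"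
  assumes meas [measurable]: "\<And>n. f n \<in> borel_measurable M"
    and int: "\<And>n. integrable M (\<lambda>x. (f n x)\<^sup>2)"
    and cauchy: "\<And>e. 0 < e \<Longrightarrow> \<exists>N. \<forall>m\<ge>N. \<forall>n\<ge>N. (\<integral>x. (f m x - f n x)\<^sup>2 \<partial>M) < e"
  obtains g where "g \<in> borel_measurable M" "integrable M (\<lambda>x. (g x)\<^sup>2)"
    "(\<lambda>n. \<integral>x. (f n x - g x)\<^sup>2 \<partial>M) \<longlonglongrightarrow> 0"
proof -
  have intd: "integrable M (\<lambda>x. (f m x - f n x)\<^sup>2)" for m n
    using integrable_square_add[of "f m" M "\<lambda>x. - f n x"] int by simp
  have nn: "(\<integral>\<^sup>+x. ennreal ((f m x - f n x)\<^sup>2) \<partial>M) = ennreal (\<integral>x. (f m x - f n x)\<^sup>2 \<partial>M)" for m n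
    by (rule nn_integral_eq_integral[OF intd]) simp
  obtain N where N: "\<And>k m n. m \<ge> N k \<Longrightarrow> n \<ge> N k \<Longrightarrow> (\<integral>x. (f m x - f n x)\<^sup>2 \<partial>M) < (1/4::real) ^ k"
    using cauchy[of "(1/4::real) ^ k" for k] by (metis zero_less_power zero_less_divide_1_iff zero_less_numeral)
  \<comment> \<open>Partial sums make \<open>r\<close> increasing, so \<open>r k\<close> and
    \<open>r (Suc k)\<close> are both at least \<open>N k\<close>; the summand \<open>k\<close>
    drives \<open>r\<close> to infinity.\<close>
  define r where "r k = (\<Sum>j\<le>k. N j) + k" for k
  have r_ge: "r k \<ge> N k" "r k \<ge> k" for k
    unfolding r_def by (simp_all add: member_le_sum trans_le_add1)
  have r_Suc: "r (Suc k) \<ge> N k" for k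
    using r_ge(1)[of k] by (simp add: r_def)
  define h where "h k x = f (r (Suc k)) x - f (r k) x" for k x
  have [measurable]: "h k \<in> borel_measurable M" for k
    unfolding h_def by measurable
  have "(\<integral>\<^sup>+x. (\<Sum>k. ennreal (2 ^ k * (h k x)\<^sup>2)) \<partial>M) = (\<Sum>k. \<integral>\<^sup>+x. ennreal (2 ^ k * (h k x)\<^sup>2) \<partial>M)"
    by (rule nn_integral_suminf) measurable
  also have "\<dots> \<le> (\<Sum>k. ennreal ((1/2) ^ k))"
  proof (intro suminf_le)
    fix k
    have "(\<integral>\<^sup>+x. ennreal (2 ^ k * (h k x)\<^sup>2) \<partial>M) = ennreal (2 ^ k) * (\<integral>\<^sup>+x. ennreal ((h k x)\<^sup>2) \<partial>M)"
      by (subst nn_integral_cmult[symmetric]) (auto simp: ennreal_mult)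
    also have "\<dots> \<le> ennreal (2 ^ k) * ennreal ((1/4) ^ k)"
      unfolding h_def nn using N[OF r_Suc r_ge(1), of k] by (intro mult_left_mono ennreal_leI) auto
    also have "\<dots> = ennreal ((1/2) ^ k)"
      by (subst ennreal_mult[symmetric]) (auto simp: power_mult_distrib[symmetric])
    finally show "(\<integral>\<^sup>+x. ennreal (2 ^ k * (h k x)\<^sup>2) \<partial>M) \<le> ennreal ((1/2) ^ k)" .
  qed auto
  also have "\<dots> < \<infinity>"
    by (subst suminf_ennreal2) (auto intro!: summable_geometric)
  finally have "(\<integral>\<^sup>+x. (\<Sum>k. ennreal (2 ^ k * (h k x)\<^sup>2)) \<partial>M) \<noteq> \<infinity>"
    by simp
  then have AE_fin: "AE x in M. (\<Sum>k. ennreal (2 ^ k * (h k x)\<^sup>2)) \<noteq> \<infinity>"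
    by (intro nn_integral_PInf_AE) measurable
  have AE_conv: "AE x in M. convergent (\<lambda>k. f (r k) x)"
    using AE_fin
  proof eventually_elim
    case (elim x)
    have "summable (\<lambda>k. 2 ^ k * (h k x)\<^sup>2)"
      using elim by (intro summable_suminf_not_top) auto
    then have "summable (\<lambda>k. 2 ^ k * (h k x)\<^sup>2 + (1/2) ^ k)"
      by (intro summable_add) (auto intro!: summable_geometric)
    moreover have "norm (h k x) \<le> 2 ^ k * (h k x)\<^sup>2 + (1/2) ^ k" for k
    proof -
      have "0 \<le> (2 ^ k * \<bar>h k x\<bar> - 1)\<^sup>2" by simp
      also have "\<dots> = 2 ^ k * (2 ^ k * (h k x)\<^sup>2 + (1/2) ^ k - 2 * \<bar>h k x\<bar>)"
        by (simp add: power2_eq_square algebra_simps power_one_over)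
      finally have "2 ^ k * (2 * \<bar>h k x\<bar>) \<le> 2 ^ k * (2 ^ k * (h k x)\<^sup>2 + (1/2) ^ k)"
        unfolding right_diff_distrib by linarith
      then have "2 * \<bar>h k x\<bar> \<le> 2 ^ k * (h k x)\<^sup>2 + (1/2) ^ k"
        by (rule mult_left_le_imp_le) simp
      then show ?thesis by simp
    qed
    ultimately have "summable (\<lambda>k. h k x)"
      by (intro summable_comparison_test[of "\<lambda>k. h k x"]) auto
    then have "convergent (\<lambda>n. \<Sum>k<n. h k x)"
      by (simp add: summable_iff_convergent)
    moreover have "(\<Sum>k<n. h k x) = f (r n) x - f (r 0) x" for n
      unfolding h_def by (rule sum_lessThan_telescope)
    ultimately have "convergent (\<lambda>n. (f (r n) x - f (r 0) x) + f (r 0) x)"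
      by (intro convergent_add) (auto simp: convergent_const)
    then show ?case by simp
  qed
  \<comment> \<open>Where the subsequence diverges, \<open>lim\<close> takes a fixed default value;
    this happens only within a null set, and \<open>g\<close> is measurable all the same.\<close>
  define g where "g x = lim (\<lambda>k. f (r k) x)" for x
  have [measurable]: "g \<in> borel_measurable M"
    unfolding g_def by measurable
  \<comment> \<open>The first index of the Cauchy estimate stays fixed while the second is sent to
    infinity along \<open>r\<close>.\<close>
  have fatou: "(\<integral>\<^sup>+x. ennreal ((f n x - g x)\<^sup>2) \<partial>M) \<le> ennreal e"
    if "\<And>k. k \<ge> K \<Longrightarrow> (\<integral>x. (f n x - f k x)\<^sup>2 \<partial>M) \<le> e" for n e K
  proof -
    have "AE x in M. ennreal ((f n x - g x)\<^sup>2) = liminf (\<lambda>k. ennreal ((f n x - f (r k) x)\<^sup>2))"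
      using AE_conv
    proof eventually_elim
      case (elim x)
      then have "(\<lambda>k. f (r k) x) \<longlonglongrightarrow> g x"
        unfolding g_def by (simp add: convergent_LIMSEQ_iff)
      then have "(\<lambda>k. ennreal ((f n x - f (r k) x)\<^sup>2)) \<longlonglongrightarrow> ennreal ((f n x - g x)\<^sup>2)"
        by (intro tendsto_intros)
      then show ?case
        by (intro lim_imp_Liminf[symmetric]) auto
    qed
    then have "(\<integral>\<^sup>+x. ennreal ((f n x - g x)\<^sup>2) \<partial>M) =
        (\<integral>\<^sup>+x. liminf (\<lambda>k. ennreal ((f n x - f (r k) x)\<^sup>2)) \<partial>M)"
      by (rule nn_integral_cong_AE)
    also have "\<dots> \<le> liminf (\<lambda>k. \<integral>\<^sup>+x. ennreal ((f n x - f (r k) x)\<^sup>2) \<partial>M)"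
      by (rule nn_integral_liminf) measurable
    also have "\<dots> \<le> ennreal e"
    proof (intro Liminf_le)
      have "r k \<ge> K" if "k \<ge> K" for k
        using that r_ge(2)[of k] by linarith
      then show "\<forall>\<^sub>F k in sequentially. (\<integral>\<^sup>+x. ennreal ((f n x - f (r k) x)\<^sup>2) \<partial>M) \<le> ennreal e"
        unfolding nn using that by (intro eventually_sequentiallyI[of K] ennreal_leI) auto
    qed simp
    finally show ?thesis .
  qed
  have main: "\<exists>N. \<forall>n\<ge>N. (\<integral>\<^sup>+x. ennreal ((f n x - g x)\<^sup>2) \<partial>M) \<le> ennreal e" if "0 < e" for e
    using cauchy[OF that] fatou by (metis less_imp_le)
  obtain n0 where n0: "(\<integral>\<^sup>+x. ennreal ((f n0 x - g x)\<^sup>2) \<partial>M) \<le> ennreal 1"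
    using main[of 1] by auto
  have int0: "integrable M (\<lambda>x. (g x - f n0 x)\<^sup>2)"
  proof (rule integrableI_nonneg)
    show "(\<integral>\<^sup>+x. ennreal ((g x - f n0 x)\<^sup>2) \<partial>M) < \<infinity>"
      using le_less_trans[OF n0 ennreal_less_top] by (simp add: power2_commute)
  qed auto
  have intg: "integrable M (\<lambda>x. (g x)\<^sup>2)"
    using integrable_square_add[of "\<lambda>x. g x - f n0 x" M "f n0"] int0 int by simp
  have intfg: "integrable M (\<lambda>x. (f n x - g x)\<^sup>2)" for n
    using integrable_square_add[of "f n" M "\<lambda>x. - g x"] int intg by simp
  have "(\<lambda>n. \<integral>x. (f n x - g x)\<^sup>2 \<partial>M) \<longlonglongrightarrow> 0"
  proof (rule LIMSEQ_I)
    fix e :: real assume "0 < e"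
    obtain N where N: "\<And>n. n \<ge> N \<Longrightarrow> (\<integral>\<^sup>+x. ennreal ((f n x - g x)\<^sup>2) \<partial>M) \<le> ennreal (e/2)"
      using main[of "e/2"] \<open>0 < e\<close> by auto
    have "(\<integral>x. (f n x - g x)\<^sup>2 \<partial>M) \<le> e/2" if "n \<ge> N" for n
      using N[OF that] \<open>0 < e\<close> by (subst (asm) nn_integral_eq_integral[OF intfg]) auto
    then show "\<exists>N. \<forall>n\<ge>N. norm ((\<integral>x. (f n x - g x)\<^sup>2 \<partial>M) - 0) < e"
      using \<open>0 < e\<close> by (intro exI[of _ N]) (force simp: integral_nonneg_AE)
  qed
  then show ?thesis
    using that[of g] intg by simp
qed

section \<open>Function spaces and forms on them\<close>

text \<open>Phrased with the same pointwise lambda terms as \<open>linear_functional_on\<close>, so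
  that membership and linearity facts combine directly.\<close>

definition function_subspace :: "('a \<Rightarrow> 'b::real_vector) set \<Rightarrow> bool" where
  "function_subspace X \<longleftrightarrow>
     (\<lambda>_. 0) \<in> X \<and> (\<forall>v\<in>X. \<forall>w\<in>X. (\<lambda>x. v x + w x) \<in> X) \<and> (\<forall>k. \<forall>v\<in>X. (\<lambda>x. k *\<^sub>R v x) \<in> X)"

lemma function_subspace_zero: "function_subspace X \<Longrightarrow> (\<lambda>_. 0) \<in> X"
  and function_subspace_add:
    "function_subspace X \<Longrightarrow> v \<in> X \<Longrightarrow> w \<in> X \<Longrightarrow> (\<lambda>x. v x + w x) \<in> X"
  and function_subspace_scale: "function_subspace X \<Longrightarrow> v \<in> X \<Longrightarrow> (\<lambda>x. k *\<^sub>R v x) \<in> X"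
  unfolding function_subspace_def by blast+

lemma function_subspace_diff:
  "function_subspace X \<Longrightarrow> v \<in> X \<Longrightarrow> w \<in> X \<Longrightarrow> (\<lambda>x. v x - w x) \<in> X"
  using function_subspace_add[OF _ _ function_subspace_scale[of X w "-1"]] by simp

lemma function_subspace_sum:
  assumes "function_subspace X" "finite S" "\<And>i. i \<in> S \<Longrightarrow> v i \<in> X"
  shows "(\<lambda>x. \<Sum>i\<in>S. v i x) \<in> X"
  using assms(2,3)
  by (induction S rule: finite_induct)
    (simp_all add: function_subspace_zero function_subspace_add assms(1))

lemma linear_functional_on_add:
    "linear_functional_on X \<phi> \<Longrightarrow> v \<in> X \<Longrightarrow> w \<in> X \<Longrightarrow> \<phi> (\<lambda>x. v x + w x) = \<phi> v + \<phi> w"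
  and linear_functional_on_scale:
    "linear_functional_on X \<phi> \<Longrightarrow> v \<in> X \<Longrightarrow> \<phi> (\<lambda>x. k *\<^sub>R v x) = k * \<phi> v"
  unfolding linear_functional_on_def by blast+

lemma linear_functional_on_diff:
  assumes "function_subspace X" "linear_functional_on X \<phi>" "v \<in> X" "w \<in> X"
  shows "\<phi> (\<lambda>x. v x - w x) = \<phi> v - \<phi> w"
  using linear_functional_on_add[OF assms(2,3) function_subspace_scale[OF assms(1,4), of "-1"]]
    linear_functional_on_scale[OF assms(2,4), of "-1"] by simp

lemma linear_functional_on_sum:
  assumes "function_subspace X" "linear_functional_on X \<phi>" "finite S" "\<And>i. i \<in> S \<Longrightarrow> v i \<in> X"
  shows "\<phi> (\<lambda>x. \<Sum>i\<in>S. v i x) = (\<Sum>i\<in>S. \<phi> (v i))"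
  using assms(3,4)
proof (induction S rule: finite_induct)
  case empty
  show ?case
    using linear_functional_on_scale[OF assms(2) function_subspace_zero[OF assms(1)], of 0] by simp
next
  case (insert i S)
  then show ?case
    using linear_functional_on_add[OF assms(2), of "v i" "\<lambda>x. \<Sum>i\<in>S. v i x"]
      function_subspace_sum[OF assms(1) insert.hyps(1)] by simp
qed

lemma bilinear_form_on_left: "bilinear_form_on X Y e \<Longrightarrow> w \<in> Y \<Longrightarrow> linear_functional_on X (\<lambda>v. e v w)"
  and bilinear_form_on_right: "bilinear_form_on X Y e \<Longrightarrow> v \<in> X \<Longrightarrow> linear_functional_on Y (e v)"
  unfolding bilinear_form_on_def by blast+

text \<open>Serves for the variation of an energy, as a substitute for the Cauchy-Schwarz
  inequality, and to expand the squares of \<open>p + L x\<close> and \<open>x + p\<close>.\<close>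

lemma quadratic_form_add_scale:
  assumes "function_subspace X" "bilinear_form_on X X e" "symmetric_form_on X e" "v \<in> X" "w \<in> X"
  shows "e (\<lambda>x. v x + t *\<^sub>R w x) (\<lambda>x. v x + t *\<^sub>R w x) = e v v + 2 * t * e v w + t\<^sup>2 * e w w"
proof -
  note sub = function_subspace_scale[OF assms(1,5), of t]
  note mem = function_subspace_add[OF assms(1,4) sub]
  have right: "e u (\<lambda>x. v x + t *\<^sub>R w x) = e u v + t * e u w" if "u \<in> X" for u
    using linear_functional_on_add[OF bilinear_form_on_right[OF assms(2) that] assms(4) sub]
      linear_functional_on_scale[OF bilinear_form_on_right[OF assms(2) that] assms(5)] by simp
  have left: "e (\<lambda>x. v x + t *\<^sub>R w x) u = e v u + t * e w u" if "u \<in> X" for u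
    using linear_functional_on_add[OF bilinear_form_on_left[OF assms(2) that] assms(4) sub]
      linear_functional_on_scale[OF bilinear_form_on_left[OF assms(2) that] assms(5)] by simp
  have "e w v = e v w"
    using assms(3-5) by (simp add: symmetric_form_on_def)
  then show ?thesis
    using assms(4,5) by (simp add: left[OF mem] right power2_eq_square algebra_simps)
qed

section \<open>The space \<open>L2\<close> and its norm\<close>

lemma L2_iff:
  "f \<in> L2 \<Omega> \<longleftrightarrow> f \<in> borel_measurable (lebesgue_on \<Omega>) \<and> integrable (lebesgue_on \<Omega>) (\<lambda>x. (f x)\<^sup>2)"
  by (simp add: L2_def)

lemma function_subspace_L2: "function_subspace (L2 \<Omega>)"
  unfolding function_subspace_def by (auto simp: L2_iff power_mult_distrib intro: integrable_square_add)

lemma L2_mult_integrable: "u \<in> L2 \<Omega> \<Longrightarrow> v \<in> L2 \<Omega> \<Longrightarrow> integrable (lebesgue_on \<Omega>) (\<lambda>x. u x * v x)"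
  by (auto simp: L2_iff intro: integrable_mult_square)

lemma L2_norm_nonneg: "0 \<le> L2_norm \<Omega> f"
  by (simp add: L2_norm_def)

lemma L2_norm_square: "(L2_norm \<Omega> f)\<^sup>2 = integral\<^sup>L (lebesgue_on \<Omega>) (\<lambda>x. (f x)\<^sup>2)"
  by (simp add: L2_norm_def)

lemma L2_norm_scale: "L2_norm \<Omega> (\<lambda>x. k * f x) = \<bar>k\<bar> * L2_norm \<Omega> f"
  by (simp add: L2_norm_def power_mult_distrib real_sqrt_mult)

text \<open>For null sequences the bound
  \<open>(a + b)\<^sup>2 \<le> 2 * a\<^sup>2 + 2 * b\<^sup>2\<close> does the work of the triangle
  inequality.\<close>

lemma L2_norm_tendsto_add:
  assumes "\<And>k. f k \<in> L2 \<Omega>" "\<And>k. g k \<in> L2 \<Omega>"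
    and "(\<lambda>k. L2_norm \<Omega> (f k)) \<longlonglongrightarrow> 0" "(\<lambda>k. L2_norm \<Omega> (g k)) \<longlonglongrightarrow> 0"
  shows "(\<lambda>k. L2_norm \<Omega> (\<lambda>x. f k x + g k x)) \<longlonglongrightarrow> 0"
proof (rule tendsto_sandwich[OF _ _ tendsto_const])
  show "(\<lambda>k. sqrt (2 * (L2_norm \<Omega> (f k))\<^sup>2 + 2 * (L2_norm \<Omega> (g k))\<^sup>2)) \<longlonglongrightarrow> 0"
    using assms(3,4) by (auto intro!: tendsto_eq_intros)
  have "(L2_norm \<Omega> (\<lambda>x. f k x + g k x))\<^sup>2 \<le> 2 * (L2_norm \<Omega> (f k))\<^sup>2 + 2 * (L2_norm \<Omega> (g k))\<^sup>2" for k
  proof -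
    have "(L2_norm \<Omega> (\<lambda>x. f k x + g k x))\<^sup>2
        \<le> integral\<^sup>L (lebesgue_on \<Omega>) (\<lambda>x. 2 * (f k x)\<^sup>2 + 2 * (g k x)\<^sup>2)"
      unfolding L2_norm_square
      using assms(1,2)[of k] integrable_square_add[of "f k" "lebesgue_on \<Omega>" "g k"]
      by (intro integral_mono) (auto simp: L2_iff sum_square_le)
    then show ?thesis
      using assms(1,2)[of k] unfolding L2_norm_square by (simp add: L2_iff)
  qed
  then show "\<forall>\<^sub>F k in sequentially. L2_norm \<Omega> (\<lambda>x. f k x + g k x)
      \<le> sqrt (2 * (L2_norm \<Omega> (f k))\<^sup>2 + 2 * (L2_norm \<Omega> (g k))\<^sup>2)"
    by (simp add: real_le_rsqrt)
qed (simp add: L2_norm_nonneg)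

section \<open>Partial derivatives, smooth functions and test functions\<close>

lemma partial_deriv_add:
  assumes "f differentiable (at x)" "g differentiable (at x)"
  shows "partial_deriv i (\<lambda>x. f x + g x) x = partial_deriv i f x + partial_deriv i g x"
  using frechet_derivative_at[OF has_derivative_add[OF assms[unfolded frechet_derivative_works]]]
  unfolding partial_deriv_def by metis

lemma partial_deriv_scale:
  assumes "f differentiable (at x)"
  shows "partial_deriv i (\<lambda>x. k * f x) x = k * partial_deriv i f x"
  using frechet_derivative_at[OF has_derivative_mult_right[OF assms[unfolded frechet_derivative_works]]]
  unfolding partial_deriv_def by metis

lemma smooth_add:
  assumes "smooth f" "smooth g"
  shows "smooth (\<lambda>x. f x + g x)"
proof -
  have "iter_partial js (\<lambda>x. f x + g x) = (\<lambda>x. iter_partial js f x + iter_partial js g x)" for js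
    by (induction js) (use assms in \<open>auto simp: smooth_def partial_deriv_add\<close>)
  then show ?thesis
    using assms by (simp add: smooth_def)
qed

lemma smooth_scale:
  assumes "smooth f"
  shows "smooth (\<lambda>x. k * f x)"
proof -
  have "iter_partial js (\<lambda>x. k * f x) = (\<lambda>x. k * iter_partial js f x)" for js
    by (induction js) (use assms in \<open>auto simp: smooth_def partial_deriv_scale\<close>)
  then show ?thesis
    using assms by (simp add: smooth_def)
qed

lemma smooth_zero: "smooth (\<lambda>_::real^'m. 0)"
proof -
  have "iter_partial js (\<lambda>_. 0) = (\<lambda>_. 0)" for js :: "'m list"
    by (induction js) (auto simp: partial_deriv_def frechet_derivative_const)
  then show ?thesis
    by (simp add: smooth_def)
qed

lemma smooth_differentiable:
  assumes "smooth f"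
  shows "f differentiable (at x)" "partial_deriv i f differentiable (at x)"
  using assms[unfolded smooth_def, rule_format, of "[]"]
    assms[unfolded smooth_def, rule_format, of "[i]"] by simp_all

lemma function_subspace_test_functions: "function_subspace (test_functions \<Omega>)"
  unfolding function_subspace_def
proof (intro conjI ballI allI)
  show "(\<lambda>_. 0) \<in> test_functions \<Omega>"
    by (auto simp: test_functions_def smooth_zero intro: exI[of _ "{}"])
  fix v assume v: "v \<in> test_functions \<Omega>"
  then show "(\<lambda>x. k *\<^sub>R v x) \<in> test_functions \<Omega>" for k
    by (force simp: test_functions_def intro: smooth_scale)
  fix w assume "w \<in> test_functions \<Omega>"
  then obtain K L where "compact K" "K \<subseteq> \<Omega>" "\<forall>x. x \<notin> K \<longrightarrow> v x = 0"
      "compact L" "L \<subseteq> \<Omega>" "\<forall>x. x \<notin> L \<longrightarrow> w x = 0" "smooth v" "smooth w"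
    using v unfolding test_functions_def by blast
  then show "(\<lambda>x. v x + w x) \<in> test_functions \<Omega>"
    unfolding test_functions_def mem_Collect_eq by (intro conjI smooth_add exI[of _ "K \<union> L"]) auto
qed

text \<open>Such a function is bounded everywhere, and bounded measurable functions are square
  integrable over a set of finite measure.\<close>

lemma continuous_compact_support_L2:
  assumes "continuous_on UNIV f" "compact K" "\<And>x. x \<notin> K \<Longrightarrow> f x = 0" "\<Omega> \<in> lmeasurable"
  shows "f \<in> L2 \<Omega>"
proof -
  have "bounded (f ` K)"
    using assms(1,2) by (meson compact_continuous_image compact_imp_bounded continuous_on_subset subset_UNIV)
  then obtain B where B: "\<And>x. x \<in> K \<Longrightarrow> \<bar>f x\<bar> \<le> B"
    unfolding bounded_iff by auto
  then have bnd: "\<bar>f x\<bar> \<le> \<bar>B\<bar>" for x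
    using assms(3)[of x] by (cases "x \<in> K") force+
  have meas: "f \<in> borel_measurable (lebesgue_on \<Omega>)"
    using assms(1,4) by (meson continuous_imp_measurable_on_sets_lebesgue continuous_on_subset
        fmeasurableD subset_UNIV)
  have fin: "finite_measure (lebesgue_on \<Omega>)"
    using assms(4) by (rule finite_measure_lebesgue_on)
  have "norm ((f x)\<^sup>2) \<le> B\<^sup>2" for x
    using bnd[of x] by (simp add: abs_le_square_iff)
  then have "integrable (lebesgue_on \<Omega>) (\<lambda>x. (f x)\<^sup>2)"
    using meas by (intro finite_measure.integrable_const_bound[OF fin, of _ "B\<^sup>2"]) auto
  with meas show ?thesis
    by (simp add: L2_iff)
qed

lemma test_function_L2:
  assumes "\<phi> \<in> test_functions \<Omega>" "\<Omega> \<in> lmeasurable"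
  shows "\<phi> \<in> L2 \<Omega>" "partial_deriv i \<phi> \<in> L2 \<Omega>"
proof -
  from assms(1) obtain K where K: "compact K" "\<And>x. x \<notin> K \<Longrightarrow> \<phi> x = 0" and "smooth \<phi>"
    unfolding test_functions_def by blast
  have cont: "continuous_on UNIV \<phi>" "continuous_on UNIV (partial_deriv i \<phi>)"
    using smooth_differentiable[OF \<open>smooth \<phi>\<close>]
    by (simp_all add: differentiable_imp_continuous_on differentiable_on_def)
  show "\<phi> \<in> L2 \<Omega>"
    by (rule continuous_compact_support_L2[OF cont(1) K assms(2)])
  have "partial_deriv i \<phi> x = 0" if "x \<notin> K" for x
  proof -
    \<comment> \<open>Off \<open>K\<close> the function vanishes on a whole neighbourhood, so its
      derivative there is zero.\<close>
    have "open (- K)"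
      using K(1) by (simp add: compact_imp_closed open_Compl)
    have "(\<phi> has_derivative (\<lambda>_. 0)) (at x)"
      by (rule has_derivative_transform_within_open[of "\<lambda>_. 0" _ _ _ "- K"])
        (use that K \<open>open (- K)\<close> in auto)
    from frechet_derivative_at[OF this] show ?thesis
      by (metis partial_deriv_def)
  qed
  then show "partial_deriv i \<phi> \<in> L2 \<Omega>"
    by (rule continuous_compact_support_L2[OF cont(2) K(1) _ assms(2)])
qed

section \<open>Weak gradients and the space \<open>H10\<close>\<close>

lemma has_weak_gradient_add:
  assumes \<Omega>: "\<Omega> \<in> lmeasurable" and "has_weak_gradient \<Omega> u g" "has_weak_gradient \<Omega> v h"
  shows "has_weak_gradient \<Omega> (\<lambda>x. u x + v x) (\<lambda>x. g x + h x)"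
  unfolding has_weak_gradient_def
proof (intro conjI ballI allI)
  note u = assms(2)[unfolded has_weak_gradient_def] and v = assms(3)[unfolded has_weak_gradient_def]
  show "(\<lambda>x. u x + v x) \<in> L2 \<Omega>" "(\<lambda>x. (g x + h x) $ i) \<in> L2 \<Omega>" for i
    using u v by (simp_all add: function_subspace_add[OF function_subspace_L2])
  fix \<phi> i assume \<phi>: "\<phi> \<in> test_functions \<Omega>"
  \<comment> \<open>Splitting the integral of a sum requires each product to be integrable.\<close>
  note int = L2_mult_integrable[OF _ test_function_L2(1)[OF \<phi> \<Omega>]]
    L2_mult_integrable[OF _ test_function_L2(2)[OF \<phi> \<Omega>]]
  show "integral\<^sup>L (lebesgue_on \<Omega>) (\<lambda>x. (u x + v x) * partial_deriv i \<phi> x) =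
      - integral\<^sup>L (lebesgue_on \<Omega>) (\<lambda>x. (g x + h x) $ i * \<phi> x)"
    using u v \<phi> int by (simp add: distrib_right)
qed

lemma has_weak_gradient_scale:
  assumes "has_weak_gradient \<Omega> u g"
  shows "has_weak_gradient \<Omega> (\<lambda>x. k * u x) (\<lambda>x. k *\<^sub>R g x)"
  unfolding has_weak_gradient_def
proof (intro conjI ballI allI)
  note u = assms[unfolded has_weak_gradient_def]
  show "(\<lambda>x. k * u x) \<in> L2 \<Omega>" "(\<lambda>x. (k *\<^sub>R g x) $ i) \<in> L2 \<Omega>" for i
    using u function_subspace_scale[OF function_subspace_L2, of u \<Omega> k]
      function_subspace_scale[OF function_subspace_L2, of "\<lambda>x. g x $ i" \<Omega> k] by simp_all
  fix \<phi> i assume "\<phi> \<in> test_functions \<Omega>"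
  with u show "integral\<^sup>L (lebesgue_on \<Omega>) (\<lambda>x. k * u x * partial_deriv i \<phi> x) =
      - integral\<^sup>L (lebesgue_on \<Omega>) (\<lambda>x. (k *\<^sub>R g x) $ i * \<phi> x)"
    by (simp add: mult.assoc)
qed

lemma H10I:
  assumes "has_weak_gradient \<Omega> u g" "\<And>k. \<phi> k \<in> test_functions \<Omega>"
    and "(\<lambda>k. L2_norm \<Omega> (\<lambda>x. \<phi> k x - u x)) \<longlonglongrightarrow> 0"
    and "\<And>i. (\<lambda>k. L2_norm \<Omega> (\<lambda>x. partial_deriv i (\<phi> k) x - g x $ i)) \<longlonglongrightarrow> 0"
  shows "u \<in> H10 \<Omega>"
  unfolding H10_def mem_Collect_eq
  by (rule exI[of _ g], rule conjI[OF assms(1)], rule exI[of _ \<phi>], intro conjI allI assms)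

lemma H10E:
  assumes "u \<in> H10 \<Omega>"
  obtains g \<phi> where "has_weak_gradient \<Omega> u g" "\<And>k::nat. \<phi> k \<in> test_functions \<Omega>"
    "(\<lambda>k. L2_norm \<Omega> (\<lambda>x. \<phi> k x - u x)) \<longlonglongrightarrow> 0"
    "\<And>i. (\<lambda>k. L2_norm \<Omega> (\<lambda>x. partial_deriv i (\<phi> k) x - g x $ i)) \<longlonglongrightarrow> 0"
  using assms unfolding H10_def mem_Collect_eq by (elim exE conjE) (rule that, (assumption | erule spec)+)

lemma H10_subset_L2: "H10 \<Omega> \<subseteq> L2 \<Omega>"
  unfolding H10_def has_weak_gradient_def by blast

text \<open>Approximating sequences are added and scaled termwise. Finite measure of \<Omega> puts
  the test functions and their derivatives into \<open>L2\<close>.\<close>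

lemma function_subspace_H10:
  assumes \<Omega>: "\<Omega> \<in> lmeasurable"
  shows "function_subspace (H10 \<Omega>)"
  unfolding function_subspace_def
proof (intro conjI ballI allI)
  show "(\<lambda>_. 0) \<in> H10 \<Omega>"
  proof (rule H10I)
    show "has_weak_gradient \<Omega> (\<lambda>_. 0) (\<lambda>_. 0)"
      using function_subspace_zero[OF function_subspace_L2, of \<Omega>] by (simp add: has_weak_gradient_def)
    show "(\<lambda>_. 0) \<in> test_functions \<Omega>"
      by (rule function_subspace_zero[OF function_subspace_test_functions])
  qed (simp_all add: L2_norm_def partial_deriv_def frechet_derivative_const)
next
  note dL2 = function_subspace_diff[OF function_subspace_L2]
  fix u v assume "u \<in> H10 \<Omega>" "v \<in> H10 \<Omega>"
  obtain g \<phi> where g: "has_weak_gradient \<Omega> u g" and \<phi>: "\<And>k::nat. \<phi> k \<in> test_functions \<Omega>"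
    and lim\<phi>: "(\<lambda>k. L2_norm \<Omega> (\<lambda>x. \<phi> k x - u x)) \<longlonglongrightarrow> 0"
      "\<And>i. (\<lambda>k. L2_norm \<Omega> (\<lambda>x. partial_deriv i (\<phi> k) x - g x $ i)) \<longlonglongrightarrow> 0"
    by (rule H10E[OF \<open>u \<in> H10 \<Omega>\<close>]) (rule that, simp_all)
  obtain h \<psi> where h: "has_weak_gradient \<Omega> v h" and \<psi>: "\<And>k::nat. \<psi> k \<in> test_functions \<Omega>"
    and lim\<psi>: "(\<lambda>k. L2_norm \<Omega> (\<lambda>x. \<psi> k x - v x)) \<longlonglongrightarrow> 0"
      "\<And>i. (\<lambda>k. L2_norm \<Omega> (\<lambda>x. partial_deriv i (\<psi> k) x - h x $ i)) \<longlonglongrightarrow> 0"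
    by (rule H10E[OF \<open>v \<in> H10 \<Omega>\<close>]) (rule that, simp_all)
  have sm: "smooth (\<phi> k)" "smooth (\<psi> k)" for k
    using \<phi>[of k] \<psi>[of k] by (simp_all add: test_functions_def)
  have mem: "u \<in> L2 \<Omega>" "v \<in> L2 \<Omega>" "(\<lambda>x. g x $ i) \<in> L2 \<Omega>" "(\<lambda>x. h x $ i) \<in> L2 \<Omega>" for i
    using g h by (simp_all add: has_weak_gradient_def)
  show "(\<lambda>x. u x + v x) \<in> H10 \<Omega>"
  proof (rule H10I[OF has_weak_gradient_add[OF \<Omega> g h]])
    show "(\<lambda>x. \<phi> k x + \<psi> k x) \<in> test_functions \<Omega>" for k
      by (rule function_subspace_add[OF function_subspace_test_functions \<phi> \<psi>])
    have "(\<lambda>k. L2_norm \<Omega> (\<lambda>x. (\<phi> k x - u x) + (\<psi> k x - v x))) \<longlonglongrightarrow> 0"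
      by (rule L2_norm_tendsto_add[OF dL2[OF test_function_L2(1)[OF \<phi> \<Omega>] mem(1)]
            dL2[OF test_function_L2(1)[OF \<psi> \<Omega>] mem(2)] lim\<phi>(1) lim\<psi>(1)])
    then show "(\<lambda>k. L2_norm \<Omega> (\<lambda>x. (\<phi> k x + \<psi> k x) - (u x + v x))) \<longlonglongrightarrow> 0"
      by (simp only: add_diff_add)
    fix i
    have "(\<lambda>k. L2_norm \<Omega> (\<lambda>x. (partial_deriv i (\<phi> k) x - g x $ i) +
        (partial_deriv i (\<psi> k) x - h x $ i))) \<longlonglongrightarrow> 0"
      by (rule L2_norm_tendsto_add[OF dL2[OF test_function_L2(2)[OF \<phi> \<Omega>] mem(3)]
            dL2[OF test_function_L2(2)[OF \<psi> \<Omega>] mem(4)] lim\<phi>(2) lim\<psi>(2)])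
    then show "(\<lambda>k. L2_norm \<Omega> (\<lambda>x. partial_deriv i (\<lambda>x. \<phi> k x + \<psi> k x) x - (g x + h x) $ i))
        \<longlonglongrightarrow> 0"
      by (simp only: partial_deriv_add[OF smooth_differentiable(1) smooth_differentiable(1), OF sm]
          vector_add_component add_diff_add)
  qed
next
  fix k u assume "u \<in> H10 \<Omega>"
  obtain g \<phi> where g: "has_weak_gradient \<Omega> u g" and \<phi>: "\<And>n::nat. \<phi> n \<in> test_functions \<Omega>"
    and lim: "(\<lambda>n. L2_norm \<Omega> (\<lambda>x. \<phi> n x - u x)) \<longlonglongrightarrow> 0"
      "\<And>i. (\<lambda>n. L2_norm \<Omega> (\<lambda>x. partial_deriv i (\<phi> n) x - g x $ i)) \<longlonglongrightarrow> 0"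
    by (rule H10E[OF \<open>u \<in> H10 \<Omega>\<close>]) (rule that, simp_all)
  have sm: "smooth (\<phi> n)" for n
    using \<phi>[of n] by (simp add: test_functions_def)
  have "(\<lambda>x. k * u x) \<in> H10 \<Omega>"
  proof (rule H10I[OF has_weak_gradient_scale[OF g]])
    show "(\<lambda>x. k * \<phi> n x) \<in> test_functions \<Omega>" for n
      using function_subspace_scale[OF function_subspace_test_functions \<phi>, of k n] by simp
    have "(\<lambda>n. L2_norm \<Omega> (\<lambda>x. k * (\<phi> n x - u x))) \<longlonglongrightarrow> 0"
      unfolding L2_norm_scale using lim(1) by (rule tendsto_mult_right_zero)
    then show "(\<lambda>n. L2_norm \<Omega> (\<lambda>x. k * \<phi> n x - k * u x)) \<longlonglongrightarrow> 0"
      by (simp only: right_diff_distrib)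
    fix i
    have "(\<lambda>n. L2_norm \<Omega> (\<lambda>x. k * (partial_deriv i (\<phi> n) x - g x $ i))) \<longlonglongrightarrow> 0"
      unfolding L2_norm_scale using lim(2) by (rule tendsto_mult_right_zero)
    then show "(\<lambda>n. L2_norm \<Omega> (\<lambda>x. partial_deriv i (\<lambda>x. k * \<phi> n x) x - (k *\<^sub>R g x) $ i)) \<longlonglongrightarrow> 0"
      by (simp only: partial_deriv_scale[OF smooth_differentiable(1)[OF sm]]
          vector_scaleR_component real_scaleR_def right_diff_distrib)
  qed
  then show "(\<lambda>x. k *\<^sub>R u x) \<in> H10 \<Omega>"
    by simp
qed

lemma function_subspace_H10_vec: "\<Omega> \<in> lmeasurable \<Longrightarrow> function_subspace (H10_vec \<Omega>)"
  using function_subspace_H10[of \<Omega>] unfolding function_subspace_def H10_vec_def by simp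

section \<open>Elliptic forms and the representation of functionals on \<open>L2\<close>\<close>

lemma sym_cont_elliptic_formD:
  assumes "sym_cont_elliptic_form X N \<kappa> e"
  shows "bilinear_form_on X X e" "symmetric_form_on X e" "0 < \<kappa>"
    "\<And>v. v \<in> X \<Longrightarrow> \<kappa> * (N v)\<^sup>2 \<le> e v v"
    "\<And>v. v \<in> X \<Longrightarrow> 0 \<le> e v v"
proof -
  show 1: "bilinear_form_on X X e" "symmetric_form_on X e" "0 < \<kappa>"
    and 2: "\<And>v. v \<in> X \<Longrightarrow> \<kappa> * (N v)\<^sup>2 \<le> e v v"
    using assms by (auto simp: sym_cont_elliptic_form_def elliptic_form_on_def)
  show "0 \<le> e v v" if "v \<in> X" for v
    by (rule order_trans[OF _ 2[OF that]]) (use 1 in simp)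
qed

text \<open>For small \<open>t\<close> of sign opposite to \<open>a\<close> the linear term would
  dominate. This turns minimality in every direction into an equation.\<close>

lemma linear_coefficient_eq_zero:
  fixes a b :: real
  assumes "\<And>t. 0 \<le> 2 * t * a + t\<^sup>2 * b"
  shows "a = 0"
proof (rule ccontr)
  assume "a \<noteq> 0"
  \<comment> \<open>The summand 1 keeps \<open>B\<close> positive even if \<open>b = 0\<close>; then
    \<open>t = - a / B\<close> gives at most \<open>- (a\<^sup>2 / B)\<close>.\<close>
  define B where "B = \<bar>b\<bar> + 1"
  have "B > 0" "b \<le> B"
    by (auto simp: B_def)
  have "0 \<le> 2 * (- a / B) * a + (- a / B)\<^sup>2 * b"
    by (rule assms)
  also have "\<dots> \<le> 2 * (- a / B) * a + (- a / B)\<^sup>2 * B"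
    using \<open>b \<le> B\<close> by (intro add_left_mono mult_left_mono) auto
  also have "\<dots> = - (a\<^sup>2 / B)"
    using \<open>B > 0\<close> by (simp add: power2_eq_square field_simps)
  also have "\<dots> < 0"
    using \<open>B > 0\<close> \<open>a \<noteq> 0\<close> by simp
  finally show False by simp
qed

text \<open>
  A minimizing sequence of the energy \<open>e(q, q) - 2 \<phi>(q)\<close> is Cauchy by the parallelogram law, and its
  limit satisfies the Euler--Lagrange equation.
\<close>

lemma L2_form_representation:
  assumes form: "sym_cont_elliptic_form (L2 \<Omega>) (L2_norm \<Omega>) \<kappa> e"
    and lin: "linear_functional_on (L2 \<Omega>) \<phi>"
    and bnd: "\<And>q. q \<in> L2 \<Omega> \<Longrightarrow> \<bar>\<phi> q\<bar> \<le> K * L2_norm \<Omega> q"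
  shows "\<exists>p\<in>L2 \<Omega>. \<forall>q\<in>L2 \<Omega>. e p q = \<phi> q"
proof -
  note sub = function_subspace_L2[of \<Omega>]
  note bil = sym_cont_elliptic_formD[OF form]
  obtain K' where K': "\<And>v w. v \<in> L2 \<Omega> \<Longrightarrow> w \<in> L2 \<Omega> \<Longrightarrow> \<bar>e v w\<bar> \<le> K' * L2_norm \<Omega> v * L2_norm \<Omega> w"
    using form by (auto simp: sym_cont_elliptic_form_def continuous_form_on_def)
  define J where "J q = e q q - 2 * \<phi> q" for q
  have shift: "J (\<lambda>x. v x + t *\<^sub>R w x) = J v + 2 * t * (e v w - \<phi> w) + t\<^sup>2 * e w w"
    if "v \<in> L2 \<Omega>" "w \<in> L2 \<Omega>" for v w t
    using quadratic_form_add_scale[OF sub bil(1,2) that, of t]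
      linear_functional_on_add[OF lin that(1) function_subspace_scale[OF sub that(2), of t]]
      linear_functional_on_scale[OF lin that(2), of t]
    unfolding J_def by (simp add: algebra_simps)
  have lower: "- (K\<^sup>2 / \<kappa>) \<le> J q" if "q \<in> L2 \<Omega>" for q
  proof -
    \<comment> \<open>Completing the square in the norm of \<open>q\<close> bounds the energy below,
      so that its infimum is meaningful.\<close>
    have "0 \<le> \<kappa> * (L2_norm \<Omega> q - K / \<kappa>)\<^sup>2"
      using bil(3) by simp
    also have "\<dots> = \<kappa> * (L2_norm \<Omega> q)\<^sup>2 - 2 * (K * L2_norm \<Omega> q) + K\<^sup>2 / \<kappa>"
      using bil(3) by (simp add: power2_eq_square field_simps)
    also have "\<dots> \<le> J q + K\<^sup>2 / \<kappa>"
      using bil(4)[OF that] bnd[OF that] by (simp add: J_def)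
    finally show ?thesis by simp
  qed
  define m where "m = Inf (J ` L2 \<Omega>)"
  have m: "m \<le> J q" if "q \<in> L2 \<Omega>" for q
    unfolding m_def using that lower by (intro cInf_lower bdd_belowI2[of _ "- (K\<^sup>2 / \<kappa>)"]) auto
  have "\<exists>q\<in>L2 \<Omega>. J q < m + 1 / Suc n" for n
  proof -
    have "J ` L2 \<Omega> \<noteq> {}"
      using function_subspace_zero[OF sub] by blast
    then show ?thesis
      using cInf_lessD[of "J ` L2 \<Omega>" "m + 1 / Suc n"] by (auto simp: m_def)
  qed
  then obtain q where q: "\<And>n. q n \<in> L2 \<Omega>" "\<And>n. J (q n) < m + 1 / Suc n"
    by metis
  have energy: "\<kappa> * (\<integral>x. (q i x - q j x)\<^sup>2 \<partial>lebesgue_on \<Omega>) \<le> 2 * (1 / Suc i + 1 / Suc j)" for i j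
  proof -
    let ?w = "\<lambda>x. q i x - q j x"
    have w: "?w \<in> L2 \<Omega>"
      by (rule function_subspace_diff[OF sub q(1) q(1)])
    have "J (q i) = J (q j) + 2 * (e (q j) ?w - \<phi> ?w) + e ?w ?w"
      using shift[OF q(1)[of j] w, of 1] by simp
    \<comment> \<open>The energy at the midpoint of \<open>q i\<close> and \<open>q j\<close> is
      still at least \<open>m\<close>; eliminating the linear term leaves a bound on
      \<open>e ?w ?w\<close>.\<close>
    moreover have "m \<le> J (q j) + (e (q j) ?w - \<phi> ?w) + e ?w ?w / 4"
      using m[OF function_subspace_add[OF sub q(1)[of j] function_subspace_scale[OF sub w, of "1/2"]]]
        shift[OF q(1)[of j] w, of "1/2"] by (simp add: power2_eq_square)
    ultimately have "e ?w ?w \<le> 2 * (1 / Suc i + 1 / Suc j)"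
      using q(2)[of i] q(2)[of j] by argo
    then show ?thesis
      using bil(4)[OF w] by (simp add: L2_norm_square)
  qed
  have cauchy: "\<exists>N. \<forall>i\<ge>N. \<forall>j\<ge>N. (\<integral>x. (q i x - q j x)\<^sup>2 \<partial>lebesgue_on \<Omega>) < r" if "0 < r" for r
  proof -
    have "0 < r * \<kappa> / 4"
      using that bil(3) by simp
    then obtain N where "inverse (real (Suc N)) < r * \<kappa> / 4"
      using reals_Archimedean by blast
    then have N: "1 / Suc N < r * \<kappa> / 4"
      by (simp only: inverse_eq_divide)
    have "(\<integral>x. (q i x - q j x)\<^sup>2 \<partial>lebesgue_on \<Omega>) < r" if "i \<ge> N" "j \<ge> N" for i j
    proof -
      have "1 / Suc i \<le> 1 / Suc N" "1 / Suc j \<le> 1 / Suc N"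
        using that by (simp_all add: frac_le)
      then have "\<kappa> * (\<integral>x. (q i x - q j x)\<^sup>2 \<partial>lebesgue_on \<Omega>) < \<kappa> * r"
        using energy[of i j] N by (simp only: mult.commute[of r]) argo
      then show ?thesis
        using bil(3) by simp
    qed
    then show ?thesis by blast
  qed
  obtain p where p: "p \<in> L2 \<Omega>" and lim: "(\<lambda>n. \<integral>x. (q n x - p x)\<^sup>2 \<partial>lebesgue_on \<Omega>) \<longlonglongrightarrow> 0"
    using L2_complete[OF _ _ cauchy] q(1) by (auto simp: L2_iff)
  have "e p v = \<phi> v" if v: "v \<in> L2 \<Omega>" for v
  proof -
    have "(\<lambda>n. K' * sqrt (\<integral>x. (q n x - p x)\<^sup>2 \<partial>lebesgue_on \<Omega>) * L2_norm \<Omega> v) \<longlonglongrightarrow> K' * sqrt 0 * L2_norm \<Omega> v"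
      by (intro tendsto_intros lim)
    moreover have "norm (e (q n) v - e p v) \<le> K' * sqrt (\<integral>x. (q n x - p x)\<^sup>2 \<partial>lebesgue_on \<Omega>) * L2_norm \<Omega> v"
      for n
      using K'[OF function_subspace_diff[OF sub q(1)[of n] p] v]
        linear_functional_on_diff[OF sub bilinear_form_on_left[OF bil(1) v] q(1)[of n] p]
      by (simp add: L2_norm_def[of \<Omega> "\<lambda>x. q n x - p x"])
    ultimately have "(\<lambda>n. e (q n) v - e p v) \<longlonglongrightarrow> 0"
      by (intro Lim_null_comparison[of "\<lambda>n. e (q n) v - e p v"]) auto
    then have conv: "(\<lambda>n. e (q n) v) \<longlonglongrightarrow> e p v"
      by (rule LIM_zero_cancel)
    \<comment> \<open>Here \<open>m \<le> J (q n + t v)\<close> and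
      \<open>J (q n) < m + 1 / Suc n\<close> are combined before the limit, so convergence of
      \<open>e (q n) v\<close> suffices and continuity of \<open>J\<close> is avoided.\<close>
    have "0 \<le> 2 * t * (e p v - \<phi> v) + t\<^sup>2 * e v v" for t
    proof (rule LIMSEQ_le_const)
      have "(\<lambda>n. 1 / Suc n + 2 * t * (e (q n) v - \<phi> v) + t\<^sup>2 * e v v)
          \<longlonglongrightarrow> 0 + 2 * t * (e p v - \<phi> v) + t\<^sup>2 * e v v"
        using LIMSEQ_inverse_real_of_nat by (intro tendsto_intros conv) (simp add: inverse_eq_divide)
      then show "(\<lambda>n. 1 / Suc n + 2 * t * (e (q n) v - \<phi> v) + t\<^sup>2 * e v v)
          \<longlonglongrightarrow> 2 * t * (e p v - \<phi> v) + t\<^sup>2 * e v v"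
        by simp
      show "\<exists>N. \<forall>n\<ge>N. 0 \<le> 1 / Suc n + 2 * t * (e (q n) v - \<phi> v) + t\<^sup>2 * e v v"
        using m[OF function_subspace_add[OF sub q(1) function_subspace_scale[OF sub v, of t]]]
          shift[OF q(1) v, of _ t] q(2) by (smt (verit, ccfv_threshold))
    qed
    then show ?thesis
      using linear_coefficient_eq_zero[of "e p v - \<phi> v" "e v v"] by simp
  qed
  then show ?thesis
    using p by blast
qed

section \<open>One step of the iteration\<close>

text \<open>\<open>Q\<close> is the matrix of algebraic stability and \<open>G\<close> the Gram
  matrix of the stages. Their entrywise product has nonnegative sum, which is twice the claimed sum
  minus the form of \<open>G\<close> at \<beta>, itself nonnegative.\<close>

lemma algebraically_stable_form_nonneg:
  fixes A :: "real^'s^'s"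
  assumes stable: "algebraically_stable A \<beta>"
    and sub: "function_subspace X" and bil: "bilinear_form_on X X e" and sym: "symmetric_form_on X e"
    and pos: "\<And>v. v \<in> X \<Longrightarrow> 0 \<le> e v v"
    and p: "\<And>l. p l \<in> X"
  shows "0 \<le> (\<Sum>k\<in>UNIV. \<beta> $ k * (\<Sum>l\<in>UNIV. A $ k $ l * e (p l) (p k)))"
proof -
  define Q where "Q k l = \<beta> $ k * A $ k $ l + A $ l $ k * \<beta> $ l - \<beta> $ k * \<beta> $ l" for k l
  define G where "G k l = e (p k) (p l)" for k l
  let ?M = "diag \<beta> ** A + transpose A ** diag \<beta> - (\<chi> i j. \<beta> $ i * \<beta> $ j)"
  have M: "?M $ k $ l = Q k l" for k l
    by (simp add: Q_def matrix_matrix_mult_def diag_def transpose_def if_distrib if_distribR cong: if_cong)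
  have Gsym: "G k l = G l k" for k l
    using sym p by (simp add: G_def symmetric_form_on_def)
  have Gpsd: "0 \<le> (\<Sum>k\<in>UNIV. \<Sum>l\<in>UNIV. y k * y l * G k l)" for y :: "'s \<Rightarrow> real"
  proof -
    note mem = function_subspace_scale[OF sub p]
    let ?s = "\<lambda>x. \<Sum>k\<in>UNIV. y k *\<^sub>R p k x"
    have s: "?s \<in> X"
      by (rule function_subspace_sum[OF sub]) (auto intro: mem)
    have right: "e v ?s = (\<Sum>l\<in>UNIV. y l * e v (p l))" if "v \<in> X" for v
      using linear_functional_on_sum[OF sub bilinear_form_on_right[OF bil that], of UNIV "\<lambda>k x. y k *\<^sub>R p k x"]
        linear_functional_on_scale[OF bilinear_form_on_right[OF bil that] p] mem by simp
    have "e ?s ?s = (\<Sum>k\<in>UNIV. y k * e (p k) ?s)"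
      using linear_functional_on_sum[OF sub bilinear_form_on_left[OF bil s], of UNIV "\<lambda>k x. y k *\<^sub>R p k x"]
        linear_functional_on_scale[OF bilinear_form_on_left[OF bil s] p] mem by simp
    also have "\<dots> = (\<Sum>k\<in>UNIV. \<Sum>l\<in>UNIV. y k * y l * G k l)"
      by (simp add: right[OF p] sum_distrib_left G_def mult.assoc)
    finally show ?thesis
      using pos[OF s] by simp
  qed
  have "0 \<le> (\<Sum>k\<in>UNIV. \<Sum>l\<in>UNIV. Q k l * G k l)"
  proof (rule psd_kernel_inner_nonneg[OF _ _ _ Gpsd])
    show "Q k l = Q l k" for k l
      by (simp add: Q_def)
    show "0 \<le> (\<Sum>k\<in>UNIV. \<Sum>l\<in>UNIV. x k * x l * Q k l)" for x :: "'s \<Rightarrow> real"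
    proof -
      have "(\<chi> k. x k) \<bullet> (?M *v (\<chi> k. x k)) = (\<Sum>k\<in>UNIV. \<Sum>l\<in>UNIV. x k * x l * Q k l)"
        unfolding inner_vec_def matrix_vector_mult_def M
        by (simp add: sum_distrib_left mult.assoc mult.left_commute mult.commute)
      moreover have "0 \<le> (\<chi> k. x k) \<bullet> (?M *v (\<chi> k. x k))"
        using stable unfolding algebraically_stable_def positive_semidefinite_def by blast
      ultimately show ?thesis
        by (simp only:)
    qed
  qed simp
  also have "(\<Sum>k\<in>UNIV. \<Sum>l\<in>UNIV. Q k l * G k l) =
      (\<Sum>k\<in>UNIV. \<Sum>l\<in>UNIV. \<beta> $ k * A $ k $ l * G k l) + (\<Sum>k\<in>UNIV. \<Sum>l\<in>UNIV. \<beta> $ l * A $ l $ k * G k l)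
      - (\<Sum>k\<in>UNIV. \<Sum>l\<in>UNIV. \<beta> $ k * \<beta> $ l * G k l)"
    by (simp add: Q_def algebra_simps sum.distrib sum_subtractf)
  \<comment> \<open>Since \<open>G\<close> is symmetric, the transposed term of \<open>Q\<close>
    contributes the same sum.\<close>
  also have "(\<Sum>k\<in>UNIV. \<Sum>l\<in>UNIV. \<beta> $ l * A $ l $ k * G k l) = (\<Sum>k\<in>UNIV. \<Sum>l\<in>UNIV. \<beta> $ k * A $ k $ l * G k l)"
    by (subst sum.swap) (simp only: Gsym)
  finally have "0 \<le> (\<Sum>k\<in>UNIV. \<Sum>l\<in>UNIV. \<beta> $ k * A $ k $ l * G k l)"
    using Gpsd[of "\<lambda>k. \<beta> $ k"] by simp
  also have "\<dots> = (\<Sum>k\<in>UNIV. \<beta> $ k * (\<Sum>l\<in>UNIV. A $ k $ l * G l k))"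
    by (simp only: sum_distrib_left mult.assoc Gsym)
  finally show ?thesis
    by (simp add: G_def)
qed

text \<open>Turns the flow equation, for a fixed test function, into a linear system over the
  stages.\<close>

lemma linear_functional_on_stage_deriv:
  assumes "function_subspace X" "linear_functional_on X \<phi>" "w0 \<in> X" "\<And>l. W l \<in> X"
  shows "\<phi> (stage_deriv A \<tau> w0 W l) = (\<Sum>j\<in>UNIV. matrix_inv A $ l $ j * (\<phi> (W j) - \<phi> w0)) / \<tau>"
proof -
  note diff = function_subspace_diff[OF assms(1,4,3)]
  note scale = function_subspace_scale[OF assms(1) diff]
  have sum: "(\<lambda>x. \<Sum>j\<in>UNIV. matrix_inv A $ l $ j *\<^sub>R (W j x - w0 x)) \<in> X"
    by (rule function_subspace_sum[OF assms(1)]) (auto intro: scale)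
  show ?thesis
    unfolding stage_deriv_def linear_functional_on_scale[OF assms(2) sum]
    by (subst linear_functional_on_sum[OF assms(1,2)])
      (auto intro: scale simp: linear_functional_on_scale[OF assms(2) diff]
        linear_functional_on_diff[OF assms(1,2,4,3)])
qed

lemma matrix_inv_right:
  fixes A :: "real^'s^'s"
  assumes "invertible A"
  shows "A ** matrix_inv A = mat 1"
  using someI_ex[OF assms[unfolded invertible_def]] unfolding matrix_inv_def by simp

section \<open>Coupled forms and the seminorm of \<open>M_tilde\<close>\<close>

locale coupled_forms =
  fixes \<Omega> :: "(real^'m) set"
    and a :: "(real^'m \<Rightarrow> real^'m) \<Rightarrow> (real^'m \<Rightarrow> real^'m) \<Rightarrow> real"
    and b c :: "(real^'m \<Rightarrow> real) \<Rightarrow> (real^'m \<Rightarrow> real) \<Rightarrow> real"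
    and d :: "(real^'m \<Rightarrow> real^'m) \<Rightarrow> (real^'m \<Rightarrow> real) \<Rightarrow> real"
    and c\<^sub>a c\<^sub>b c\<^sub>c C\<^sub>d :: real
  assumes \<Omega>: "\<Omega> \<in> lmeasurable"
    and a: "sym_cont_elliptic_form (H10_vec \<Omega>) (H1_vec_norm \<Omega>) c\<^sub>a a"
    and b: "sym_cont_elliptic_form (H10 \<Omega>) (H1_norm \<Omega>) c\<^sub>b b"
    and c: "sym_cont_elliptic_form (L2 \<Omega>) (L2_norm \<Omega>) c\<^sub>c c"
    and d: "bilinear_form_on (H10_vec \<Omega>) (L2 \<Omega>) d"
    and C\<^sub>d: "0 < C\<^sub>d"
    and d_le: "\<forall>u\<in>H10_vec \<Omega>. \<forall>p\<in>L2 \<Omega>. d u p \<le> C\<^sub>d * H1_vec_norm \<Omega> u * L2_norm \<Omega> p"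
begin

lemmas a_form = sym_cont_elliptic_formD[OF a]
lemmas b_form = sym_cont_elliptic_formD[OF b]
lemmas c_form = sym_cont_elliptic_formD[OF c]

definition \<omega> :: real where
  "\<omega> = C\<^sub>d\<^sup>2 / (c\<^sub>a * c\<^sub>c)"

text \<open>The Riesz representative of \<open>d v\<close> for the inner product \<open>c\<close>;
  the same term occurs inside \<open>M_tilde\<close>.\<close>

definition C_inv_D :: "(real^'m \<Rightarrow> real^'m) \<Rightarrow> real^'m \<Rightarrow> real" where
  "C_inv_D v = inv_into (L2 \<Omega>) (form_op (L2 \<Omega>) c) (form_op (L2 \<Omega>) d v)"

text \<open>\<open>inv_into\<close> is meaningful only on the image of
  \<open>form_op (L2 \<Omega>) c\<close>; \<open>L2_form_representation\<close> places
  \<open>d v\<close> there.\<close>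

lemma C_inv_D:
  assumes v: "v \<in> H10_vec \<Omega>"
  shows C_inv_D_L2: "C_inv_D v \<in> L2 \<Omega>"
    and c_C_inv_D: "\<And>q. q \<in> L2 \<Omega> \<Longrightarrow> c (C_inv_D v) q = d v q"
proof -
  note lin = bilinear_form_on_right[OF d v]
  have "\<bar>d v q\<bar> \<le> C\<^sub>d * H1_vec_norm \<Omega> v * L2_norm \<Omega> q" if q: "q \<in> L2 \<Omega>" for q
  proof -
    \<comment> \<open>The bound on \<open>d\<close> is one-sided; applying it to \<open>- q\<close>
      bounds the absolute value.\<close>
    have "- d v q \<le> C\<^sub>d * H1_vec_norm \<Omega> v * L2_norm \<Omega> (\<lambda>x. - 1 *\<^sub>R q x)"
      using d_le v function_subspace_scale[OF function_subspace_L2 q, of "- 1"]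
        linear_functional_on_scale[OF lin q, of "- 1"] by fastforce
    also have "L2_norm \<Omega> (\<lambda>x. - 1 *\<^sub>R q x) = L2_norm \<Omega> q"
      using L2_norm_scale[of \<Omega> "- 1" q] by simp
    finally show ?thesis
      using d_le v q by (simp add: abs_le_iff)
  qed
  from L2_form_representation[OF c lin this] obtain p
    where p: "p \<in> L2 \<Omega>" "\<forall>q\<in>L2 \<Omega>. c p q = d v q"
    by blast
  then have "form_op (L2 \<Omega>) d v = form_op (L2 \<Omega>) c p"
    by (auto simp: form_op_def)
  then have img: "form_op (L2 \<Omega>) d v \<in> form_op (L2 \<Omega>) c ` L2 \<Omega>"
    using p(1) by blast
  show "C_inv_D v \<in> L2 \<Omega>"
    unfolding C_inv_D_def by (rule inv_into_into[OF img])
  have "form_op (L2 \<Omega>) c (C_inv_D v) = form_op (L2 \<Omega>) d v"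
    unfolding C_inv_D_def by (rule f_inv_into_f[OF img])
  then show "c (C_inv_D v) q = d v q" if "q \<in> L2 \<Omega>" for q
    using that by (metis form_op_def restrict_apply')
qed

lemma c_commute: "v \<in> L2 \<Omega> \<Longrightarrow> w \<in> L2 \<Omega> \<Longrightarrow> c v w = c w v"
  using c_form(2) by (simp add: symmetric_form_on_def)

text \<open>The left side is \<open>d w (C_inv_D v)\<close>, to which the defining property of
  \<open>C_inv_D w\<close> applies.\<close>

lemma M_tilde_eq:
  assumes "v \<in> H10_vec \<Omega>" "w \<in> H10_vec \<Omega>"
  shows "M_tilde \<Omega> c d v w = c (C_inv_D w) (C_inv_D v)"
  using assms C_inv_D_L2 c_C_inv_D
  by (simp add: M_tilde_def form_op_adj_def flip: C_inv_D_def)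

lemma M_seminorm_square:
  "v \<in> H10_vec \<Omega> \<Longrightarrow> (M_seminorm \<Omega> c d v)\<^sup>2 = c (C_inv_D v) (C_inv_D v)"
  using c_form(5)[OF C_inv_D_L2] by (simp add: M_seminorm_def M_tilde_eq)

lemma coupling_pos: "0 < \<omega>"
  using C\<^sub>d a_form(3) c_form(3) by (simp add: \<omega>_def)

text \<open>The left side \<open>s\<close> equals \<open>d v (C_inv_D v)\<close>, hence is at most
  \<open>C\<^sub>d * N * r\<close>. After squaring, \<open>c\<^sub>c * r\<^sup>2 \<le> s\<close>
  lets one factor \<open>s\<close> cancel, and ellipticity of \<open>a\<close> absorbs
  \<open>N\<^sup>2\<close>.\<close>

lemma c_C_inv_D_le:
  assumes v: "v \<in> H10_vec \<Omega>"
  shows "c (C_inv_D v) (C_inv_D v) \<le> \<omega> * a v v"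
proof -
  define s where "s = c (C_inv_D v) (C_inv_D v)"
  define N where "N = H1_vec_norm \<Omega> v"
  define r where "r = L2_norm \<Omega> (C_inv_D v)"
  have s0: "0 \<le> s"
    unfolding s_def by (rule c_form(5)[OF C_inv_D_L2[OF v]])
  have "s \<le> C\<^sub>d * N * r"
    using d_le v C_inv_D_L2[OF v] c_C_inv_D[OF v C_inv_D_L2[OF v]] by (simp add: s_def N_def r_def)
  then have "s\<^sup>2 \<le> (C\<^sub>d * N * r)\<^sup>2"
    using s0 by (rule power_mono)
  then have "c\<^sub>c * (s * s) \<le> (C\<^sub>d * N)\<^sup>2 * (c\<^sub>c * r\<^sup>2)"
    using c_form(3) by (simp add: power_mult_distrib power2_eq_square mult_ac)
  also have "\<dots> \<le> (C\<^sub>d * N)\<^sup>2 * s"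
    using c_form(4)[OF C_inv_D_L2[OF v]] by (intro mult_left_mono) (simp_all add: s_def r_def)
  finally have "(c\<^sub>c * s) * s \<le> (C\<^sub>d * N)\<^sup>2 * s"
    by (simp add: mult.assoc)
  then have "c\<^sub>c * s \<le> (C\<^sub>d * N)\<^sup>2"
    using s0 by (cases "s = 0") auto
  then have "c\<^sub>a * (c\<^sub>c * s) \<le> c\<^sub>a * (C\<^sub>d * N)\<^sup>2"
    using a_form(3) by (intro mult_left_mono) auto
  also have "\<dots> = C\<^sub>d\<^sup>2 * (c\<^sub>a * N\<^sup>2)"
    by (simp add: power_mult_distrib)
  also have "\<dots> \<le> C\<^sub>d\<^sup>2 * a v v"
    using a_form(4)[OF v] by (intro mult_left_mono) (simp_all add: N_def)
  finally show ?thesis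
    using a_form(3) c_form(3) unfolding s_def[symmetric] \<omega>_def by (simp add: field_simps)
qed

text \<open>The right side is \<open>c r r\<close> for \<open>r = p l + L x l\<close>, left expanded
  so that its weighted stage sum can be combined with \<open>flow_step\<close>.\<close>

lemma mechanics_step:
  fixes U U' U'' :: "'s::finite \<Rightarrow> real^'m \<Rightarrow> real^'m" and P' P'' :: "'s \<Rightarrow> real^'m \<Rightarrow> real"
  assumes U: "\<And>l. U l \<in> H10_vec \<Omega>" "\<And>l. U' l \<in> H10_vec \<Omega>" "\<And>l. U'' l \<in> H10_vec \<Omega>"
    and P: "\<And>l. P' l \<in> H10 \<Omega>" "\<And>l. P'' l \<in> H10 \<Omega>"
    and eq1: "mechanics_equation \<Omega> a c d A \<tau> L f n U' P' U"
    and eq2: "mechanics_equation \<Omega> a c d A \<tau> L f n U'' P'' U'"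
    and L: "0 \<le> L"
  defines "y l \<equiv> C_inv_D (\<lambda>t. U l t - U' l t)" and "x l \<equiv> C_inv_D (\<lambda>t. U' l t - U'' l t)"
    and "p l \<equiv> (\<lambda>t. P' l t - P'' l t)"
  shows "(1 / \<omega> + L)\<^sup>2 * c (y l) (y l) \<le> c (p l) (p l) + 2 * L * c (x l) (p l) + L\<^sup>2 * c (x l) (x l)"
proof -
  note subV = function_subspace_H10_vec[OF \<Omega>]
  let ?v = "\<lambda>t. U l t - U' l t" and ?v' = "\<lambda>t. U' l t - U'' l t"
  have v: "?v \<in> H10_vec \<Omega>" "?v' \<in> H10_vec \<Omega>"
    by (intro function_subspace_diff[OF subV] U)+
  have PL2: "P' l \<in> L2 \<Omega>" "P'' l \<in> L2 \<Omega>"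
    using P H10_subset_L2 by blast+
  have p: "p l \<in> L2 \<Omega>"
    unfolding p_def by (rule function_subspace_diff[OF function_subspace_L2 PL2])
  have x: "x l \<in> L2 \<Omega>" and y: "y l \<in> L2 \<Omega>"
    unfolding x_def y_def by (intro C_inv_D_L2 v)+
  have "a (U l) ?v - d ?v (P' l) + L * c (y l) (y l) = f (stage_time A \<tau> n l) ?v"
    using eq1[unfolded mechanics_equation_def, rule_format, OF v(1), of l] v
    by (simp add: form_op_def form_op_adj_def M_tilde_eq y_def)
  moreover have "a (U' l) ?v - d ?v (P'' l) + L * c (y l) (x l) = f (stage_time A \<tau> n l) ?v"
    using eq2[unfolded mechanics_equation_def, rule_format, OF v(1), of l] v
    by (simp add: form_op_def form_op_adj_def M_tilde_eq x_def y_def)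
  moreover have "a ?v ?v = a (U l) ?v - a (U' l) ?v"
    by (rule linear_functional_on_diff[OF subV bilinear_form_on_left[OF a_form(1) v(1)] U(1,2)])
  moreover have "c (y l) (p l) = d ?v (P' l) - d ?v (P'' l)"
    using linear_functional_on_diff[OF function_subspace_L2 bilinear_form_on_right[OF d v(1)] PL2] p
    by (simp add: y_def c_C_inv_D[OF v(1)] p_def)
  ultimately have energy: "a ?v ?v + L * c (y l) (y l) = c (y l) (p l) + L * c (y l) (x l)"
    by argo
  define r where "r = (\<lambda>t. p l t + L *\<^sub>R x l t)"
  have r: "r \<in> L2 \<Omega>"
    unfolding r_def
    by (rule function_subspace_add[OF function_subspace_L2 p function_subspace_scale[OF function_subspace_L2 x]])
  have "c (y l) r = c (y l) (p l) + L * c (y l) (x l)"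
    unfolding r_def
    using linear_functional_on_add[OF bilinear_form_on_right[OF c_form(1) y] p
        function_subspace_scale[OF function_subspace_L2 x, of L]]
      linear_functional_on_scale[OF bilinear_form_on_right[OF c_form(1) y] x, of L] by simp
  moreover have "1 / \<omega> * c (y l) (y l) \<le> a ?v ?v"
    using c_C_inv_D_le[OF v(1)] coupling_pos by (simp add: y_def pos_divide_le_eq mult.commute)
  ultimately have test: "(1 / \<omega> + L) * c (y l) (y l) \<le> c r (y l)"
    using energy c_commute[OF y r] unfolding distrib_right by linarith
  \<comment> \<open>Nonnegativity of the square of \<open>r - (1 / \<omega> + L) y\<close> replaces
    Cauchy-Schwarz and avoids dividing by the norm of \<open>y\<close>.\<close>
  have "0 \<le> c r r + 2 * - (1 / \<omega> + L) * c r (y l) + (- (1 / \<omega> + L))\<^sup>2 * c (y l) (y l)"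
    using quadratic_form_add_scale[OF function_subspace_L2 c_form(1,2) r y, of "- (1 / \<omega> + L)"]
      c_form(5)[OF function_subspace_add[OF function_subspace_L2 r
          function_subspace_scale[OF function_subspace_L2 y, of "- (1 / \<omega> + L)"]]] by (simp only:)
  moreover have "(1 / \<omega> + L) * ((1 / \<omega> + L) * c (y l) (y l)) \<le> (1 / \<omega> + L) * c r (y l)"
    using coupling_pos L by (intro mult_left_mono[OF test]) simp
  ultimately have "(1 / \<omega> + L)\<^sup>2 * c (y l) (y l) \<le> c r r"
    unfolding power2_minus power2_eq_square by (simp only: mult.assoc)
  also have "c r r = c (p l) (p l) + 2 * L * c (x l) (p l) + L\<^sup>2 * c (x l) (x l)"
    unfolding r_def quadratic_form_add_scale[OF function_subspace_L2 c_form(1,2) p x]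
    by (simp add: c_commute[OF p x])
  finally show ?thesis .
qed

text \<open>The data \<open>g\<close>, \<open>u0\<close>, \<open>p0\<close> cancel in the difference
  of the two flow equations; testing stage \<open>k\<close> with \<open>p k\<close> leaves
  \<open>- \<tau>\<close> times the sum treated by
  \<open>algebraically_stable_form_nonneg\<close>.\<close>

lemma flow_step:
  fixes A :: "real^'s^'s"
  assumes U: "\<And>l. U l \<in> H10_vec \<Omega>" "\<And>l. U' l \<in> H10_vec \<Omega>" "u0 \<in> H10_vec \<Omega>"
    and P: "\<And>l. P l \<in> H10 \<Omega>" "\<And>l. P' l \<in> H10 \<Omega>" "p0 \<in> H10 \<Omega>"
    and eq1: "flow_equation \<Omega> b c d A \<tau> g n u0 p0 U P"
    and eq2: "flow_equation \<Omega> b c d A \<tau> g n u0 p0 U' P'"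
    and A: "invertible A" and \<tau>: "0 < \<tau>" and stable: "algebraically_stable A \<beta>"
  defines "x l \<equiv> C_inv_D (\<lambda>t. U l t - U' l t)" and "p l \<equiv> (\<lambda>t. P l t - P' l t)"
  shows "(\<Sum>l\<in>UNIV. \<beta> $ l * (c (x l) (p l) + c (p l) (p l))) \<le> 0"
proof -
  note subV = function_subspace_H10_vec[OF \<Omega>] and subQ = function_subspace_H10[OF \<Omega>]
    and subH = function_subspace_L2[of \<Omega>]
  have PL2: "P l \<in> L2 \<Omega>" "P' l \<in> L2 \<Omega>" "p0 \<in> L2 \<Omega>" for l
    using P H10_subset_L2 by blast+
  have p: "p l \<in> H10 \<Omega>" for l
    unfolding p_def by (intro function_subspace_diff[OF subQ] P)
  \<comment> \<open>\<open>matrix_inv A\<close> couples the stages, so it is removed for one common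
    \<open>q\<close>; only afterwards may the test function depend on \<open>k\<close>.\<close>
  have w: "c (x k) q + c (p k) q = - \<tau> * (\<Sum>l\<in>UNIV. A $ k $ l * b (p l) q)" if q: "q \<in> H10 \<Omega>" for k q
  proof -
    have qL2: "q \<in> L2 \<Omega>"
      using q H10_subset_L2 by blast
    let ?w = "\<chi> j. c (x j) q + c (p j) q" and ?b = "\<chi> j. - \<tau> * b (p j) q"
    have xq: "c (x j) q = d (U j) q - d (U' j) q" for j
      unfolding x_def c_C_inv_D[OF function_subspace_diff[OF subV U(1,2)] qL2]
      by (rule linear_functional_on_diff[OF subV bilinear_form_on_left[OF d qL2] U(1,2)])
    have pq: "c (p j) q = c (P j) q - c (P' j) q" for j
      unfolding p_def by (rule linear_functional_on_diff[OF subH bilinear_form_on_left[OF c_form(1) qL2] PL2(1,2)])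
    have bq: "b (p j) q = b (P j) q - b (P' j) q" for j
      unfolding p_def by (rule linear_functional_on_diff[OF subQ bilinear_form_on_left[OF b_form(1) q] P(1,2)])
    have flow: "(\<Sum>j\<in>UNIV. matrix_inv A $ l $ j * (d (W j) q - d u0 q)) / \<tau> +
        (\<Sum>j\<in>UNIV. matrix_inv A $ l $ j * (c (R j) q - c p0 q)) / \<tau> + b (R l) q = g (stage_time A \<tau> n l) q"
      if "flow_equation \<Omega> b c d A \<tau> g n u0 p0 W R" "\<And>l. W l \<in> H10_vec \<Omega>" "\<And>l. R l \<in> L2 \<Omega>"
      for l and W :: "'s \<Rightarrow> real^'m \<Rightarrow> real^'m" and R :: "'s \<Rightarrow> real^'m \<Rightarrow> real"
      using that(1)[unfolded flow_equation_def, rule_format, OF q, of l] q qL2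
        linear_functional_on_stage_deriv[where W = W, OF subV bilinear_form_on_left[OF d qL2] U(3) that(2)]
        linear_functional_on_stage_deriv[where W = R, OF subH bilinear_form_on_left[OF c_form(1) qL2] PL2(3) that(3)]
      by (simp add: form_op_def)
    have "(matrix_inv A *v ?w) $ l = ?b $ l" for l
    proof -
      have "(matrix_inv A *v ?w) $ l =
          ((\<Sum>j\<in>UNIV. matrix_inv A $ l $ j * (d (U j) q - d u0 q)) + (\<Sum>j\<in>UNIV. matrix_inv A $ l $ j * (c (P j) q - c p0 q)))
          - ((\<Sum>j\<in>UNIV. matrix_inv A $ l $ j * (d (U' j) q - d u0 q)) + (\<Sum>j\<in>UNIV. matrix_inv A $ l $ j * (c (P' j) q - c p0 q)))"
        unfolding matrix_vector_mult_def xq pq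
        by (simp add: algebra_simps sum.distrib sum_subtractf)
      also have "\<dots> = \<tau> * (b (P' l) q - b (P l) q)"
        using flow[OF eq1 U(1) PL2(1), of l] flow[OF eq2 U(2) PL2(2), of l] \<tau>
        by (simp add: field_simps)
      finally show ?thesis
        by (simp add: bq algebra_simps)
    qed
    then have "matrix_inv A *v ?w = ?b"
      unfolding vec_eq_iff by blast
    then have "A *v (matrix_inv A *v ?w) = A *v ?b"
      by (simp only:)
    then have "?w = A *v ?b"
      by (simp add: matrix_vector_mul_assoc matrix_inv_right[OF A])
    then have "?w $ k = (A *v ?b) $ k"
      by simp
    then show ?thesis
      by (simp add: matrix_vector_mult_def sum_distrib_left mult_ac sum_negf)
  qed
  have "(\<Sum>k\<in>UNIV. \<beta> $ k * (c (x k) (p k) + c (p k) (p k))) =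
      - \<tau> * (\<Sum>k\<in>UNIV. \<beta> $ k * (\<Sum>l\<in>UNIV. A $ k $ l * b (p l) (p k)))"
    unfolding w[OF p] by (simp add: sum_distrib_left mult_ac)
  also have "\<dots> \<le> 0"
    using algebraically_stable_form_nonneg[OF stable subQ b_form(1,2,5), of p] p \<tau>
    by (simp add: mult_nonpos_nonneg)
  finally show ?thesis .
qed

lemma rho_US_eq: "0 \<le> L \<Longrightarrow> rho_US \<omega> L = max L (1 - L) / (1 / \<omega> + L)"
  using coupling_pos unfolding rho_US_def by (simp add: field_simps)

text \<open>The flow equation at iterate \<open>i\<close> is assumed separately because
  \<open>i = 0\<close> is the initial guess, for which the iteration does not provide it.\<close>

lemma undrained_split_contraction:
  fixes A :: "real^'s^'s"
  assumes it: "undrained_split_iteration \<Omega> a b c d A \<tau> L f g n u0 p0 U P"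
    and A: "invertible A" and \<tau>: "0 < \<tau>" and stable: "algebraically_stable A \<beta>"
    and \<beta>: "\<forall>l. 0 < \<beta> $ l" and L: "0 \<le> L"
    and flow: "flow_equation \<Omega> b c d A \<tau> g n u0 p0 (U i) (P i)"
  shows "M_seminorm_stages \<Omega> c d \<beta> (\<lambda>l x. U (Suc (Suc i)) l x - U (Suc i) l x)
     \<le> rho_US \<omega> L * M_seminorm_stages \<Omega> c d \<beta> (\<lambda>l x. U (Suc i) l x - U i l x)"
proof -
  note it = it[unfolded undrained_split_iteration_def]
  have mem: "U j l \<in> H10_vec \<Omega>" "P j l \<in> H10 \<Omega>" "u0 \<in> H10_vec \<Omega>" "p0 \<in> H10 \<Omega>" for j l
    using it by blast+
  have mech: "mechanics_equation \<Omega> a c d A \<tau> L f n (U j) (P j) (U (Suc j))"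
    and flow': "flow_equation \<Omega> b c d A \<tau> g n u0 p0 (U (Suc j)) (P (Suc j))" for j
    using it by (metis diff_Suc_1 le_add1 plus_1_eq_Suc)+
  define y where "y l = C_inv_D (\<lambda>t. U (Suc (Suc i)) l t - U (Suc i) l t)" for l
  define x where "x l = C_inv_D (\<lambda>t. U (Suc i) l t - U i l t)" for l
  define p where "p l = (\<lambda>t. P (Suc i) l t - P i l t)" for l
  define \<kappa> where "\<kappa> = 1 / \<omega> + L"
  have \<kappa>: "0 < \<kappa>"
    unfolding \<kappa>_def using coupling_pos L by (intro add_pos_nonneg) auto
  define Y where "Y = (\<Sum>l\<in>UNIV. \<beta> $ l * c (y l) (y l))"
  define X where "X = (\<Sum>l\<in>UNIV. \<beta> $ l * c (x l) (x l))"
  define Z where "Z = (\<Sum>l\<in>UNIV. \<beta> $ l * c (x l) (p l))"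
  define W where "W = (\<Sum>l\<in>UNIV. \<beta> $ l * c (p l) (p l))"
  have V: "(\<lambda>t. U j l t - U k l t) \<in> H10_vec \<Omega>" for j k l
    by (intro function_subspace_diff[OF function_subspace_H10_vec[OF \<Omega>]] mem)
  have xL2: "x l \<in> L2 \<Omega>" for l
    unfolding x_def by (rule C_inv_D_L2[OF V])
  have pL2: "p l \<in> L2 \<Omega>" for l
    unfolding p_def using function_subspace_diff[OF function_subspace_H10[OF \<Omega>] mem(2) mem(2)]
      H10_subset_L2 by blast
  have "0 \<le> c (x l) (x l) + 2 * c (x l) (p l) + c (p l) (p l)" for l
    using quadratic_form_add_scale[OF function_subspace_L2 c_form(1,2) xL2 pL2, of l 1 l]
      c_form(5)[OF function_subspace_add[OF function_subspace_L2 xL2 pL2], of l l] by simp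
  then have "0 \<le> (\<Sum>l\<in>UNIV. \<beta> $ l * (c (x l) (x l) + 2 * c (x l) (p l) + c (p l) (p l)))"
    using \<beta> by (intro sum_nonneg mult_nonneg_nonneg) (auto intro: less_imp_le)
  then have sq: "0 \<le> X + 2 * Z + W"
    unfolding X_def Z_def W_def by (simp add: algebra_simps sum.distrib sum_distrib_left)
  have W0: "0 \<le> W" and X0: "0 \<le> X"
    unfolding W_def X_def using \<beta> c_form(5) xL2 pL2
    by (auto intro!: sum_nonneg mult_nonneg_nonneg intro: less_imp_le)
  have diss: "Z + W \<le> 0"
    using flow_step[OF mem(1) mem(1) mem(3) mem(2) mem(2) mem(4) flow' flow A \<tau> stable]
    unfolding Z_def W_def x_def p_def by (simp add: algebra_simps sum.distrib)
  have "\<kappa>\<^sup>2 * Y = (\<Sum>l\<in>UNIV. \<beta> $ l * (\<kappa>\<^sup>2 * c (y l) (y l)))"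
    unfolding Y_def sum_distrib_left by (simp only: mult.left_commute)
  also have "\<dots> \<le> (\<Sum>l\<in>UNIV. \<beta> $ l * (c (p l) (p l) + 2 * L * c (x l) (p l) + L\<^sup>2 * c (x l) (x l)))"
    using \<beta> mechanics_step[OF mem(1) mem(1) mem(1) mem(2) mem(2) mech mech L]
    unfolding \<kappa>_def x_def y_def p_def by (intro sum_mono mult_left_mono) (auto intro: less_imp_le)
  also have "\<dots> = W + 2 * L * Z + L\<^sup>2 * X"
    unfolding W_def X_def Z_def by (simp add: algebra_simps sum.distrib sum_distrib_left)
  also have "\<dots> \<le> (max L (1 - L))\<^sup>2 * X"
  proof (cases "1/2 \<le> L")
    case True
    \<comment> \<open>Here \<open>W + 2 L Z = (2 L - 1) Z + (Z + W)\<close>, and both terms are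
      nonpositive since \<open>Z \<le> - W \<le> 0\<close>.\<close>
    then have "(2 * L - 1) * Z \<le> 0"
      using diss W0 by (intro mult_nonneg_nonpos) auto
    moreover have "max L (1 - L) = L"
      using True by simp
    ultimately show ?thesis
      using diss by (simp add: algebra_simps)
  next
    case False
    \<comment> \<open>\<open>Z + W \<le> 0\<close> gives \<open>W + 2 L Z \<le> (1 - 2 L) W\<close>,
      and together with \<open>sq\<close> also \<open>W \<le> X\<close>; finally
      \<open>1 - 2 L + L\<^sup>2 = (1 - L)\<^sup>2\<close>.\<close>
    have "L * (Z + W) \<le> 0" "(1 - 2 * L) * W \<le> (1 - 2 * L) * X"
      using False L diss sq by (auto intro!: mult_nonneg_nonpos mult_left_mono)
    then show ?thesis
      using False by (simp add: max_def power2_eq_square algebra_simps)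
  qed
  finally have "sqrt (\<kappa>\<^sup>2 * Y) \<le> sqrt ((max L (1 - L))\<^sup>2 * X)"
    by (rule real_sqrt_le_mono)
  then have "\<kappa> * sqrt Y \<le> max L (1 - L) * sqrt X"
    using \<kappa> L by (simp add: real_sqrt_mult)
  then have "sqrt Y \<le> max L (1 - L) / \<kappa> * sqrt X"
    using \<kappa> by (simp add: field_simps)
  then show ?thesis
    unfolding M_seminorm_stages_def M_seminorm_square[OF V] rho_US_eq[OF L]
    by (simp add: X_def Y_def x_def y_def \<kappa>_def)
qed

end

section \<open>Size and optimality of the contraction rate\<close>

lemma rho_US_less_one:
  assumes "0 < \<omega>" "0 \<le> L" "\<omega> * (1 - 2 * L) < 1"
  shows "rho_US \<omega> L < 1"
proof -
  have "0 < 1 + L * \<omega>"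
    using assms by (simp add: add_pos_nonneg)
  \<comment> \<open>Cross-multiplied, the claim is
    \<open>\<omega> * (max L (1 - L) - L) < 1\<close>, whose left side is 0 or
    \<open>\<omega> * (1 - 2 * L)\<close>.\<close>
  then show ?thesis
    using assms by (simp add: rho_US_def max_def algebra_simps)
qed

lemma rho_US_half: "0 < \<omega> \<Longrightarrow> rho_US \<omega> (1/2) = \<omega> / (2 + \<omega>)"
  by (simp add: rho_US_def field_simps)

text \<open>After cross-multiplication this rests on \<open>2 * max L (1 - L) > 1\<close> and
  \<open>max L (1 - L) \<ge> L\<close>. It is the optimality of \<open>L = 1/2\<close>.\<close>

lemma rho_US_half_less:
  assumes "0 < \<omega>" "0 \<le> L" "L \<noteq> 1/2"
  shows "rho_US \<omega> (1/2) < rho_US \<omega> L"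
proof -
  have pos: "0 < 1 + L * \<omega>"
    using assms by (simp add: add_pos_nonneg)
  have "1 + L * \<omega> < max L (1 - L) * (2 + \<omega>)"
  proof (cases "1/2 < L")
    case True
    then show ?thesis
      by (simp add: max_def algebra_simps)
  next
    case False
    then have "L * \<omega> < (1 - L) * \<omega>"
      using assms by (intro mult_strict_right_mono) auto
    then show ?thesis
      using False by (simp add: max_def algebra_simps)
  qed
  then have "\<omega> * (1 + L * \<omega>) < \<omega> * (max L (1 - L) * (2 + \<omega>))"
    using assms(1) by (rule mult_strict_left_mono)
  then show ?thesis
    unfolding rho_US_half[OF assms(1)] using pos assms(1)
    by (simp add: rho_US_def divide_less_eq less_divide_eq mult_ac)
qed

text \<open>At \<open>i = 2\<close> the pressure difference involves the initial guess, hence the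
  flow condition on \<open>U 0\<close>, \<open>P 0\<close> in that case; from \<open>i = 3\<close>
  on the iteration supplies it.\<close>

theorem theorem4p5:
  fixes \<Omega> :: "(real^'m) set"
    and a :: "(real^'m \<Rightarrow> real^'m) \<Rightarrow> (real^'m \<Rightarrow> real^'m) \<Rightarrow> real"
    and b c :: "(real^'m \<Rightarrow> real) \<Rightarrow> (real^'m \<Rightarrow> real) \<Rightarrow> real"
    and d :: "(real^'m \<Rightarrow> real^'m) \<Rightarrow> (real^'m \<Rightarrow> real) \<Rightarrow> real"
    and c\<^sub>a c\<^sub>b c\<^sub>c C\<^sub>d \<omega> \<tau> T :: real
    and A :: "real^'s^'s" and \<beta> :: "real^'s"
    and f :: "real \<Rightarrow> (real^'m \<Rightarrow> real^'m) \<Rightarrow> real"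
    and g :: "real \<Rightarrow> (real^'m \<Rightarrow> real) \<Rightarrow> real"
  assumes "CARD('m) \<in> {2, 3}"
    and "bounded_lipschitz_domain \<Omega>"
    and "sym_cont_elliptic_form (H10_vec \<Omega>) (H1_vec_norm \<Omega>) c\<^sub>a a"
    and "sym_cont_elliptic_form (H10 \<Omega>) (H1_norm \<Omega>) c\<^sub>b b"
    and "sym_cont_elliptic_form (L2 \<Omega>) (L2_norm \<Omega>) c\<^sub>c c"
    and "bilinear_form_on (H10_vec \<Omega>) (L2 \<Omega>) d"
    and "0 < C\<^sub>d"
    and "\<forall>u\<in>H10_vec \<Omega>. \<forall>p\<in>L2 \<Omega>. d u p \<le> C\<^sub>d * H1_vec_norm \<Omega> u * L2_norm \<Omega> p"
    and "\<omega> = C\<^sub>d\<^sup>2 / (c\<^sub>a * c\<^sub>c)"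
    and "A_stable A \<beta>"
    and "invertible A"
    and "\<bar>stability_fun_infinity A \<beta>\<bar> < 1"
    and "algebraically_stable A \<beta>"
    and "\<forall>l. 0 < \<beta> $ l"
    and "0 < \<tau>"
    and "\<forall>t\<in>{0..T}. f t \<in> dual_space (H10_vec \<Omega>) (H1_vec_norm \<Omega>)"
    and "\<forall>t\<in>{0..T}. g t \<in> dual_space (H10 \<Omega>) (H1_norm \<Omega>)"
  shows "(\<forall>L\<ge>0. \<forall>n::nat. \<forall>u0 p0 U P.
            1 \<le> n \<and> real n * \<tau> \<le> T \<and>
            undrained_split_iteration \<Omega> a b c d A \<tau> L f g n u0 p0 U P \<longrightarrow>
            (\<forall>i\<ge>2. (i = 2 \<longrightarrow> flow_equation \<Omega> b c d A \<tau> g n u0 p0 (U 0) (P 0)) \<longrightarrow>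
                 M_seminorm_stages \<Omega> c d \<beta> (\<lambda>l x. U i l x - U (i - 1) l x)
                 \<le> rho_US \<omega> L *
                    M_seminorm_stages \<Omega> c d \<beta> (\<lambda>l x. U (i - 1) l x - U (i - 2) l x)))
       \<and> (\<forall>L\<ge>1/2. rho_US \<omega> L < 1)
       \<and> (\<forall>L. 0 \<le> L \<and> L < 1/2 \<and> \<omega> < 1 / (1 - 2 * L) \<longrightarrow> rho_US \<omega> L < 1)
       \<and> (\<forall>L\<ge>0. L \<noteq> 1/2 \<longrightarrow> rho_US \<omega> (1/2) < rho_US \<omega> L)
       \<and> rho_US \<omega> (1/2) = \<omega> / (2 + \<omega>)"
proof -
  \<comment> \<open>A bounded open set has finite Lebesgue measure.\<close>
  interpret coupled_forms \<Omega> a b c d c\<^sub>a c\<^sub>b c\<^sub>c C\<^sub>d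
    using assms(2-8) lmeasurable_open
    by unfold_locales (auto simp: bounded_lipschitz_domain_def)
  \<comment> \<open>The constant of the locale and the variable of the theorem share a name; the
    qualified name tells them apart.\<close>
  have \<omega>_eq: "coupled_forms.\<omega> c\<^sub>a c\<^sub>c C\<^sub>d = \<omega>"
    unfolding assms(9) by (rule \<omega>_def)
  note pos = coupling_pos[unfolded \<omega>_eq]
  have contraction: "M_seminorm_stages \<Omega> c d \<beta> (\<lambda>l x. U i l x - U (i - 1) l x)
      \<le> rho_US \<omega> L * M_seminorm_stages \<Omega> c d \<beta> (\<lambda>l x. U (i - 1) l x - U (i - 2) l x)"
    if L: "0 \<le> L" and it: "undrained_split_iteration \<Omega> a b c d A \<tau> L f g n u0 p0 U P"
      and i: "2 \<le> i" and flow: "i = 2 \<longrightarrow> flow_equation \<Omega> b c d A \<tau> g n u0 p0 (U 0) (P 0)"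
    for L n u0 p0 U P i
  proof -
    obtain j where j: "i = Suc (Suc j)"
      using i by (metis add_2_eq_Suc le_Suc_ex)
    have "flow_equation \<Omega> b c d A \<tau> g n u0 p0 (U j) (P j)"
      \<comment> \<open>\<open>j = 0\<close> is the case \<open>i = 2\<close> of the hypothesis; a
        successor \<open>j\<close> is covered by the iteration.\<close>
      using flow it unfolding undrained_split_iteration_def j by (cases j) simp_all
    from undrained_split_contraction[OF it assms(11,15,13,14) L this] show ?thesis
      by (simp add: j \<omega>_eq)
  qed
  have "rho_US \<omega> L < 1" if "1/2 \<le> L" for L
  proof (rule rho_US_less_one[OF pos])
    have "\<omega> * (1 - 2 * L) \<le> 0"
      using that pos by (intro mult_nonneg_nonpos) auto
    then show "\<omega> * (1 - 2 * L) < 1"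
      by simp
  qed (use that in simp)
  moreover have "rho_US \<omega> L < 1" if "0 \<le> L" "L < 1/2" "\<omega> < 1 / (1 - 2 * L)" for L
    using that by (intro rho_US_less_one[OF pos]) (simp_all add: pos_less_divide_eq)
  ultimately show ?thesis
    using contraction rho_US_half_less[OF pos] rho_US_half[OF pos] by blast
qed

end
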